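(* Let $(X,\|\cdot\|)$ be a finite-dimensional real normed linear space, let $\Omega\subset B_1[0]$ be a compact subset of $X$ (not necessarily connected), and let $\mu$ be a Borel probability measure supported on $\Omega$. Assume that: (i) there are constants $c_4>1$ and $\beta\ge1$ such that for all $x\in\Omega$ and $\delta\in(0,2]$, $\ c_4^{-1}\delta^\beta\le\mu(B_\delta(x))\le c_4\delta^\beta$; (ii) there is a constant $c_5>0$ such that for all $x\in\Omega$ and $t,s\in(0,2]$, $\ \mu(\{y\in\Omega:\ t\le\|y-x\|\le t+s\})\le c_5s$. Let $\Phi:[0,\infty)\to\mathbb{R}$ satisfy $|\Phi(s)-\Phi(s')|\le|s-s'|$ for all $s,s'\in[0,2]$. Assume that there exist a partition $0=t_0<t_1<\cdots<t_\ell=2$ of $[0,2]$ and a translation-invariant linear space $X_r$ of real continuous functions on $X$ with $\dim X_r=r$ such that for each $j=1,\dots,\ell$, with $E_j=\{x\in X:\ t_{j-1}\le\|x\|\le t_j\}$, there is $f\in X_r$ with $\Phi(\|x\|)=f(x)$ for all $x\in E_j$. Let $g\in L^1(\Omega,\mu)$ with $\|g\|_{L^1(d\mu)}=1$. Then for each integer $n\ge2$ there exist points $y_1,\dots,y_n\in\Omega$ and real numbers $\lambda_1,\dots,\lambda_n$ such that $$\sup_{x\in\Omega}\left|\int_\Omega\Phi(\|x-y\|)g(y)\,d\mu(y)-\sum_{k=1}^n\lambda_k\Phi(\|x-y_k\|)\right|\le C\begin{cases}n^{-\frac12-\frac{3}{2\beta}}(\log n)^{\frac12},&1\le\beta<3,\\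 n^{-1}(\log n)^{\frac32},&\beta=3,\\ n^{-\frac{\beta+1}{2(\beta-1)}}(\log n)^{\frac12},&\beta>3,\end{cases}$$ where the constant $C$ depends only on $\dim X$, $c_4$, $c_5$, $r$, $\ell$ and $\beta$.
   Context: $B_\zeta(x)$ and $B_\zeta[x]$ denote the open and closed balls in $X$ of centre $x$ and radius $\zeta>0$ for the metric $\|x-y\|$ (the norm need not be Euclidean). A linear space $X_r$ of functions on $X$ is translation-invariant if $f(\cdot-a)\in X_r$ for every $f\in X_r$ and $a\in X$. *)

theory Defs
  imports "HOL-Probability.Probability" "HOL-Library.Function_Algebras"
begin

text \<open>
  A finite-dimensional real normed space is rendered as a Euclidean space type, used only as
  a vector space with its standard topology, together with an arbitrary norm \<open>N\<close> on it. The norm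
  has to be a variable rather than that of the type class, because constants in the theorem are
  uniform over all norms on a space of given dimension. All norms on a finite-dimensional space
  induce the same topology (\<open>is_norm_open_iff\<close> below), so \<open>compact\<close>, \<open>borel\<close> and
  \<open>continuous_on\<close> have their usual meaning with respect to \<open>N\<close>.
\<close>

definition is_norm :: "('a::real_vector \<Rightarrow> real) \<Rightarrow> bool" where
  "is_norm N \<longleftrightarrow>
     (\<forall>x. N x \<ge> 0) \<and> (\<forall>x. N x = 0 \<longleftrightarrow> x = 0) \<and>
     (\<forall>c x. N (c *\<^sub>R x) = \<bar>c\<bar> * N x) \<and> (\<forall>x y. N (x + y) \<le> N x + N y)"

definition nball :: "('a::real_vector \<Rightarrow> real) \<Rightarrow> 'a \<Rightarrow> real \<Rightarrow> 'a set" where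
  "nball N x e = {y. N (x - y) < e}"

definition ncball :: "('a::real_vector \<Rightarrow> real) \<Rightarrow> 'a \<Rightarrow> real \<Rightarrow> 'a set" where
  "ncball N x e = {y. N (x - y) \<le> e}"

lemma is_norm_equivalent:
  fixes N :: "'a::euclidean_space \<Rightarrow> real"
  assumes "is_norm N"
  obtains a b where "a > 0" "b > 0" "\<And>x. a * norm x \<le> N x" "\<And>x. N x \<le> b * norm x"
proof -
  have N0: "N x \<ge> 0" and Nz: "N x = 0 \<longleftrightarrow> x = 0" and Ns: "N (c *\<^sub>R x) = \<bar>c\<bar> * N x"
    and Nt: "N (x + y) \<le> N x + N y" for x y c
    using assms by (auto simp: is_norm_def)
  have Nsum: "N (\<Sum>i\<in>S. f i) \<le> (\<Sum>i\<in>S. N (f i))" if "finite S" for S :: "'a set" and f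
    using that
  proof (induction S)
    case empty then show ?case using Nz[of 0] by simp
  next
    case (insert i S)
    then show ?case using Nt[of "f i" "\<Sum>i\<in>S. f i"] by simp
  qed
  define b where "b = (\<Sum>i\<in>Basis. N (i::'a)) + 1"
  have b: "b > 0" unfolding b_def using N0 by (simp add: add_nonneg_pos sum_nonneg)
  have up: "N x \<le> b * norm x" for x
  proof -
    have "N x = N (\<Sum>i\<in>Basis. (x \<bullet> i) *\<^sub>R i)" by (simp add: euclidean_representation)
    also have "\<dots> \<le> (\<Sum>i\<in>Basis. N ((x \<bullet> i) *\<^sub>R i))" by (rule Nsum) simp
    also have "\<dots> \<le> (\<Sum>i\<in>Basis. norm x * N i)"
      by (intro sum_mono) (simp add: Ns N0 mult_right_mono Basis_le_norm)
    also have "\<dots> \<le> b * norm x"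
      by (simp add: b_def sum_distrib_left sum_distrib_right algebra_simps)
    finally show ?thesis .
  qed
  have lip: "\<bar>N x - N y\<bar> \<le> b * norm (x - y)" for x y
    using Nt[of "x - y" y] Nt[of "y - x" x] up[of "x - y"] up[of "y - x"]
    by (simp add: norm_minus_commute)
  have cont: "continuous_on UNIV N"
  proof (rule continuous_on_iff[THEN iffD2], intro ballI allI impI)
    fix x :: 'a and e :: real assume "e > 0"
    show "\<exists>d>0. \<forall>x'\<in>UNIV. dist x' x < d \<longrightarrow> dist (N x') (N x) < e"
    proof (intro exI[of _ "e / b"] conjI ballI impI)
      show "e / b > 0" using \<open>e > 0\<close> b by simp
      fix x' assume "dist x' x < e / b"
      then have "b * norm (x' - x) < e" using b by (simp add: dist_norm field_simps)
      then show "dist (N x') (N x) < e" using lip[of x' x] by (simp add: dist_real_def)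
    qed
  qed
  have "compact (sphere (0::'a) 1)" "sphere (0::'a) 1 \<noteq> {}" by auto
  then obtain z where z: "z \<in> sphere 0 1" "\<And>y. y \<in> sphere 0 1 \<Longrightarrow> N z \<le> N y"
    using continuous_attains_inf[of "sphere 0 1" N] continuous_on_subset[OF cont] by blast
  have "z \<noteq> 0" using z(1) by auto
  then have a: "N z > 0" using N0[of z] Nz[of z] by linarith
  have lo: "N z * norm x \<le> N x" for x
  proof (cases "x = 0")
    case True then show ?thesis using Nz[of 0] by simp
  next
    case False
    then have "N z \<le> N (inverse (norm x) *\<^sub>R x)" by (intro z(2)) simp
    then show ?thesis using False by (simp add: Ns field_simps)
  qed
  show thesis using that a b lo up by blast
qed

lemma is_norm_open_iff:
  fixes N :: "'a::euclidean_space \<Rightarrow> real"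
  assumes "is_norm N"
  shows "open S \<longleftrightarrow> (\<forall>x\<in>S. \<exists>e>0. nball N x e \<subseteq> S)"
proof -
  obtain a b where ab: "a > 0" "b > 0" "\<And>x. a * norm x \<le> N x" "\<And>x. N x \<le> b * norm x"
    using is_norm_equivalent[OF assms] by blast
  have 1: "nball N x (a * e) \<subseteq> ball x e" for x e
  proof
    fix y assume "y \<in> nball N x (a * e)"
    then have "a * norm (x - y) < a * e" using ab(3)[of "x - y"] by (simp add: nball_def)
    then show "y \<in> ball x e" using ab(1) by (simp add: dist_norm)
  qed
  have 2: "ball x (e / b) \<subseteq> nball N x e" for x e
  proof
    fix y assume "y \<in> ball x (e / b)"
    then have "b * norm (x - y) < e" using ab(2) by (simp add: dist_norm field_simps)
    then show "y \<in> nball N x e" using ab(4)[of "x - y"] by (simp add: nball_def)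
  qed
  show ?thesis
    unfolding open_contains_ball
    by (metis 1 2 ab(1,2) divide_pos_pos mult_pos_pos subset_trans)
qed

global_interpretation fun_vs: vector_space "\<lambda>(c::real) (f::'a \<Rightarrow> real) x. c * f x"
  by unfold_locales (auto simp: fun_eq_iff algebra_simps)

text \<open>
  A linear space of functions of finite dimension \<open>r\<close>. An explicit finite basis is required since
  \<open>fun_vs.dim\<close> is also \<open>0\<close> for infinite-dimensional spaces.
\<close>
definition fun_space_of_dim :: "('a \<Rightarrow> real) set \<Rightarrow> nat \<Rightarrow> bool" where
  "fun_space_of_dim V r \<longleftrightarrow>
     (\<exists>B. finite B \<and> card B = r \<and> fun_vs.independent B \<and> fun_vs.span B = V)"

definition translation_invariant :: "('a::real_vector \<Rightarrow> real) set \<Rightarrow> bool" where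
  "translation_invariant V \<longleftrightarrow> (\<forall>f\<in>V. \<forall>a. (\<lambda>x. f (x - a)) \<in> V)"

definition quadrature_rate :: "real \<Rightarrow> nat \<Rightarrow> real" where
  "quadrature_rate \<beta> n =
     (if \<beta> < 3 then real n powr (- 1 / 2 - 3 / (2 * \<beta>)) * ln (real n) powr (1 / 2)
      else if \<beta> = 3 then real n powr (- 1) * ln (real n) powr (3 / 2)
      else real n powr (- (\<beta> + 1) / (2 * (\<beta> - 1))) * ln (real n) powr (1 / 2))"

end

theory Submission
  imports Defs
begin

text \<open>
  On a fine net the measure \<open>g d\<mu>\<close> is replaced by signed point weights. The absolute weights are cut
  into about \<open>n\<close> pieces of mass at most \<open>1/n\<close>, working from a fine scale upwards: at each scale a cell
  is emitted as soon as the mass that is left in it exceeds \<open>1/n\<close>, and whatever remains at scale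
  \<open>n powr (- 1 / \<beta>)\<close> forms the last pieces. Each piece is compressed to \<open>r + 2\<close> points by an exchange
  argument that keeps its integrals against the translates of \<open>X\<^sub>r\<close>; hence it contributes an error at
  \<open>x\<close> only if a kink sphere \<open>N (x - y) = t j\<close> passes through it. By (i) and (ii) at most a constant
  times \<open>h powr (1 - \<beta>)\<close> cells of diameter \<open>h\<close> meet the kink spheres, and since mass above \<open>1/n\<close> has
  been removed at finer scales, the sum of the squared errors is controlled even when \<open>g\<close>
  concentrates. A derandomized Hoeffding argument chooses the compressions so that the errors nearly
  cancel, simultaneously for all \<open>x\<close> in a net with polynomially many points; this costs the
  logarithm.
\<close>

section \<open>Sparse reduction and balanced choices\<close>

text \<open>Since g is only integrable, the mass near a kink sphere has no a priori bound; this is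
  why many scales occur. A crossing piece of diameter about h and mass at most 1/\<nu> has squared
  error at most about h^2/\<nu> times its mass. If all cells of a comparable scale carry at most
  1/\<nu>, the mass near the kink spheres is at most about h^(1-\<beta>)/\<nu>, so scale h costs
  h^(3-\<beta>)/\<nu>^2. At the finest scale e nothing bounds the cell masses and only the total
  mass 1 is available, which costs e^2/\<nu>. The sum over dyadic h between e and \<nu> powr
  (-1/\<beta>) is dominated by its coarsest scale for \<beta> < 3 and by its finest for \<beta> > 3,
  while all scales are equal for \<beta> = 3: these are the three regimes. For \<beta> > 3 the
  choice e = \<nu> powr (-1/(\<beta>-1)) balances the two costs. A compression serves all x at once
  because translates stay in X_r, so that r moment conditions suffice. The two further conditions
  preserve the total mass and the signed mass of a piece.\<close>

lemma homogeneous_system_nontrivial_solution: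
  fixes F :: "('a \<Rightarrow> real) set"
  assumes "finite F" "finite S" "card F < card S"
  shows "\<exists>v. (\<exists>y\<in>S. v y \<noteq> 0) \<and> (\<forall>\<phi>\<in>F. (\<Sum>y\<in>S. v y * \<phi> y) = 0)"
proof -
  have "\<exists>v. (\<exists>y\<in>S. v y \<noteq> 0) \<and> (\<forall>\<phi>\<in>F. (\<Sum>y\<in>S. v y * \<phi> y) = 0)"
    if "finite F" "finite S" "card F \<le> k" "k < card S" for k and F :: "('a \<Rightarrow> real) set" and S
    using that
  proof (induction k arbitrary: F S)
    case 0
    then have "F = {}" "S \<noteq> {}" by auto
    then show ?case by (intro exI[of _ "\<lambda>_. 1"]) auto
  next
    case (Suc k)
    show ?case
    proof (cases "\<exists>\<phi>\<in>F. \<exists>y0\<in>S. \<phi> y0 \<noteq> 0")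
      case False
      have "S \<noteq> {}" using Suc by auto
      then show ?thesis using False by (intro exI[of _ "\<lambda>_. 1"]) auto
    next
      case True
      then obtain \<phi> y0 where \<phi>: "\<phi> \<in> F" and y0: "y0 \<in> S" "\<phi> y0 \<noteq> 0" by blast
      define F' where "F' = F - {\<phi>}"
      have F': "finite F'" "card F' \<le> k" "F = insert \<phi> F'"
        using Suc \<phi> by (auto simp: F'_def)
      \<comment> \<open>Gaussian elimination of the unknown at \<open>y0\<close> with pivot \<phi>.
        Distinct functionals may coincide afterwards, so the induction runs on a bound k for
        \<open>card F\<close> and not on \<open>card F\<close> itself.\<close>
      define G where "G = (\<lambda>\<psi> y. \<psi> y - (\<psi> y0 / \<phi> y0) * \<phi> y) ` F'"
      have G: "finite G" "card G \<le> k"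
        using F' card_image_le[OF F'(1)] by (auto simp: G_def intro: order.trans)
      have "\<exists>v. (\<exists>y\<in>S - {y0}. v y \<noteq> 0) \<and> (\<forall>\<phi>\<in>G. (\<Sum>y\<in>S - {y0}. v y * \<phi> y) = 0)"
        using Suc.prems G y0 by (intro Suc.IH) auto
      then obtain v where v: "\<exists>y\<in>S - {y0}. v y \<noteq> 0"
        "\<And>\<psi>. \<psi> \<in> G \<Longrightarrow> (\<Sum>y\<in>S - {y0}. v y * \<psi> y) = 0" by blast
      define c where "c = (\<Sum>y\<in>S - {y0}. v y * \<phi> y) / \<phi> y0"
      define w where "w = v(y0 := - c)"
      have split: "(\<Sum>y\<in>S. w y * \<psi> y) = (\<Sum>y\<in>S - {y0}. v y * \<psi> y) - c * \<psi> y0" for \<psi>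
      proof -
        have "(\<Sum>y\<in>S. w y * \<psi> y) = w y0 * \<psi> y0 + (\<Sum>y\<in>S - {y0}. w y * \<psi> y)"
          using Suc y0 by (intro sum.remove) auto
        also have "(\<Sum>y\<in>S - {y0}. w y * \<psi> y) = (\<Sum>y\<in>S - {y0}. v y * \<psi> y)"
          by (intro sum.cong) (auto simp: w_def)
        finally show ?thesis by (simp add: w_def)
      qed
      have "(\<Sum>y\<in>S. w y * \<psi> y) = 0" if "\<psi> \<in> F" for \<psi>
      proof (cases "\<psi> = \<phi>")
        case True then show ?thesis using y0 by (simp add: split c_def)
      next
        case False
        then have "\<psi> \<in> F'" using that F'(3) by auto
        then have "(\<lambda>y. \<psi> y - (\<psi> y0 / \<phi> y0) * \<phi> y) \<in> G" by (auto simp: G_def)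
        from v(2)[OF this]
        have "(\<Sum>y\<in>S - {y0}. v y * \<psi> y) = (\<psi> y0 / \<phi> y0) * (\<Sum>y\<in>S - {y0}. v y * \<phi> y)"
          by (simp add: algebra_simps sum_subtractf sum_distrib_left)
        then show ?thesis by (simp add: split c_def)
      qed
      moreover have "\<exists>y\<in>S. w y \<noteq> 0" using v(1) by (auto simp: w_def)
      ultimately show ?thesis by blast
    qed
  qed
  from this[of F S "card F"] show ?thesis using assms by auto
qed

text \<open>Moving along a direction that annihilates all the functionals, oriented so that the objective
  does not increase, until a weight vanishes. Conservation of the total mass (the constant
  functional) ensures that this happens.\<close>
lemma sparse_reduction:
  fixes F :: "('a \<Rightarrow> real) set" and u a :: "'a \<Rightarrow> real"
  assumes "finite F" "(\<lambda>_. 1) \<in> F" "finite S" "\<And>y. 0 \<le> u y" "\<And>y. u y \<noteq> 0 \<Longrightarrow> y \<in> S"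
  shows "\<exists>w. (\<forall>y. 0 \<le> w y) \<and> (\<forall>y. u y = 0 \<longrightarrow> w y = 0) \<and> card {y. w y \<noteq> 0} \<le> card F \<and>
     (\<forall>\<phi>\<in>F. (\<Sum>y\<in>S. w y * \<phi> y) = (\<Sum>y\<in>S. u y * \<phi> y)) \<and>
     (\<Sum>y\<in>S. w y * a y) \<le> (\<Sum>y\<in>S. u y * a y)"
  using assms(4,5)
proof (induction "card {y. u y \<noteq> 0}" arbitrary: u rule: less_induct)
  case less
  define A where "A = {y. u y \<noteq> 0}"
  have A: "A \<subseteq> S" "finite A" using less(3) finite_subset[OF _ assms(3), of A] by (auto simp: A_def)
  show ?case
  proof (cases "card A \<le> card F")
    case True
    then show ?thesis using less by (intro exI[of _ u]) (auto simp: A_def)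
  next
    case False
    then obtain v0 where v0: "\<exists>y\<in>A. v0 y \<noteq> 0" "\<And>\<phi>. \<phi> \<in> F \<Longrightarrow> (\<Sum>y\<in>A. v0 y * \<phi> y) = 0"
      using homogeneous_system_nontrivial_solution[of F A] assms(1) A by (meson not_le)
    define \<sigma> :: real where "\<sigma> = (if (\<Sum>y\<in>A. v0 y * a y) \<le> 0 then 1 else -1)"
    define v where "v y = (if y \<in> A then \<sigma> * v0 y else 0)" for y
    have sv: "(\<Sum>y\<in>S. v y * \<phi> y) = \<sigma> * (\<Sum>y\<in>A. v0 y * \<phi> y)" for \<phi>
    proof -
      have "(\<Sum>y\<in>S. v y * \<phi> y) = (\<Sum>y\<in>A. v y * \<phi> y)"
        using A assms(3) by (intro sum.mono_neutral_right) (auto simp: v_def)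
      also have "\<dots> = \<sigma> * (\<Sum>y\<in>A. v0 y * \<phi> y)"
        by (auto simp: v_def sum_distrib_left algebra_simps intro!: sum.cong)
      finally show ?thesis .
    qed
    have vF: "(\<Sum>y\<in>S. v y * \<phi> y) = 0" if "\<phi> \<in> F" for \<phi> using v0(2)[OF that] by (simp add: sv)
    have va: "(\<Sum>y\<in>S. v y * a y) \<le> 0" by (simp add: sv \<sigma>_def)
    have neg: "\<exists>y\<in>A. v y < 0"
    proof (rule ccontr)
      assume *: "\<not> ?thesis"
      have "(\<Sum>y\<in>S. v y) = 0" using vF[OF assms(2)] by simp
      moreover have "(\<Sum>y\<in>S. v y) = (\<Sum>y\<in>A. v y)"
        using A assms(3) by (intro sum.mono_neutral_right) (auto simp: v_def)
      ultimately have "(\<Sum>y\<in>A. v y) = 0" by simp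
      moreover have "\<And>y. y \<in> A \<Longrightarrow> 0 \<le> v y" using * by force
      ultimately have "\<forall>y\<in>A. v y = 0" using sum_nonneg_eq_0_iff[OF A(2)] by metis
      then show False using v0(1) by (auto simp: v_def \<sigma>_def split: if_splits)
    qed
    define B where "B = {y\<in>A. v y < 0}"
    define \<tau> where "\<tau> = Min ((\<lambda>y. u y / - v y) ` B)"
    have B: "finite B" "B \<noteq> {}" using neg A by (auto simp: B_def)
    then have "\<tau> \<in> (\<lambda>y. u y / - v y) ` B" unfolding \<tau>_def by (intro Min_in) auto
    then obtain z where z: "z \<in> B" "\<tau> = u z / - v z" by blast
    have \<tau>: "\<tau> \<ge> 0" unfolding z(2) using z(1) less(2)[of z] by (intro divide_nonneg_pos) (auto simp: B_def)
    have \<tau>le: "\<tau> * - v y \<le> u y" if "y \<in> B" for y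
    proof -
      have "\<tau> \<le> u y / - v y" unfolding \<tau>_def using that B by (intro Min_le) auto
      then show ?thesis using that by (simp add: B_def field_simps)
    qed
    define u' where "u' y = u y + \<tau> * v y" for y
    have u'0: "0 \<le> u' y" for y
    proof (cases "y \<in> B")
      case True then show ?thesis using \<tau>le[OF True] by (simp add: u'_def)
    next
      case False
      then have "v y \<ge> 0" by (auto simp: B_def v_def not_less)
      then show ?thesis using \<tau> less(2)[of y] by (simp add: u'_def)
    qed
    have u'z: "u' z = 0" using z by (simp add: u'_def B_def)
    have u'u: "u' y = 0" if "u y = 0" for y using that by (simp add: u'_def v_def A_def)
    have "{y. u' y \<noteq> 0} \<subset> A" using u'u u'z z by (auto simp: A_def B_def)
    then have lt: "card {y. u' y \<noteq> 0} < card {y. u y \<noteq> 0}"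
      using A(2) psubset_card_mono by (metis A_def)
    obtain w where w: "\<forall>y. 0 \<le> w y" "\<forall>y. u' y = 0 \<longrightarrow> w y = 0" "card {y. w y \<noteq> 0} \<le> card F"
      "\<forall>\<phi>\<in>F. (\<Sum>y\<in>S. w y * \<phi> y) = (\<Sum>y\<in>S. u' y * \<phi> y)"
      "(\<Sum>y\<in>S. w y * a y) \<le> (\<Sum>y\<in>S. u' y * a y)"
      using less(1)[OF lt] u'0 u'u less(3) by blast
    have su': "(\<Sum>y\<in>S. u' y * \<phi> y) = (\<Sum>y\<in>S. u y * \<phi> y) + \<tau> * (\<Sum>y\<in>S. v y * \<phi> y)" for \<phi>
      by (simp add: u'_def algebra_simps sum.distrib sum_distrib_left)
    have "\<tau> * (\<Sum>y\<in>S. v y * a y) \<le> 0" using \<tau> va by (simp add: mult_nonneg_nonpos)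
    then show ?thesis using w u'u su' vF by (intro exI[of _ w]) auto
  qed
qed

section \<open>A sub-Gaussian bound without probability\<close>

lemma cosh_le_exp_half_square: "cosh (x::real) \<le> exp (x\<^sup>2 / 2)"
proof -
  have *: "cosh x \<le> exp (x\<^sup>2 / 2)" if "x \<ge> 0" for x :: real
  proof -
    \<comment> \<open>Hoeffding's lemma for a symmetric two-point variable: parameter 1/2 and
      interval length 2x. The linear term -x cancels the factor exp x in exp x * cosh x, which
      leaves ln (cosh x).\<close>
    have "- (2 * x) * (1/2) + ln (1 + (1/2) * (exp (2 * x) - 1)) \<le> (2 * x)\<^sup>2 / 8"
      using that by (intro Hoeffdings_lemma_aux) auto
    moreover have "1 + (1/2) * (exp (2 * x) - 1) = exp x * cosh x"
      by (simp add: cosh_field_def algebra_simps flip: exp_add)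
    ultimately have "ln (cosh x) \<le> x\<^sup>2 / 2"
      by (simp add: ln_mult power2_eq_square)
    then have "exp (ln (cosh x)) \<le> exp (x\<^sup>2 / 2)" by (simp only: exp_le_cancel_iff)
    then show ?thesis by simp
  qed
  show ?thesis using *[of x] *[of "- x"] by (cases "x \<ge> 0") auto
qed

lemma exp_le_chord:
  fixes b z :: real
  assumes "0 < b" "\<bar>z\<bar> \<le> b"
  shows "exp z \<le> cosh b + z / b * sinh b"
proof -
  define t where "t = (z + b) / (2 * b)"
  have t: "0 \<le> t" "t \<le> 1" using assms by (auto simp: t_def field_simps)
  have "z = (1 - t) *\<^sub>R (- b) + t *\<^sub>R b" using assms by (simp add: t_def field_simps)
  then have "exp z \<le> (1 - t) * exp (- b) + t * exp b"
    using convex_onD[OF convex_on_exp[of 1] t, of "-b" b] by simp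
  also have "\<dots> = cosh b + (2 * t - 1) * sinh b"
    by (simp add: cosh_field_def sinh_field_def field_simps)
  also have "2 * t - 1 = z / b" using assms by (simp add: t_def field_simps)
  finally show ?thesis .
qed

text \<open>Each of the two exponentials in cosh (A + z) lies below its chord over [-b, b]. For
  fixed A the bound is affine in z, and its constant term cosh A * cosh b is the average that z = b
  and z = -b with equal probability would give.\<close>

lemma cosh_add_le_chord:
  fixes A b z :: real
  assumes "0 < b" "\<bar>z\<bar> \<le> b"
  shows "cosh (A + z) \<le> cosh A * cosh b + sinh A * (z / b * sinh b)"
proof -
  have "cosh (A + z) = exp A / 2 * exp z + exp (- A) / 2 * exp (- z)"
    by (simp add: cosh_field_def exp_add exp_diff exp_minus field_simps)
  also have "\<dots> \<le> exp A / 2 * (cosh b + z / b * sinh b) + exp (- A) / 2 * (cosh b + (- z) / b * sinh b)"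
    using assms by (intro add_mono mult_left_mono exp_le_chord) auto
  also have "\<dots> = cosh A * cosh b + sinh A * (z / b * sinh b)"
    by (simp add: cosh_field_def sinh_field_def algebra_simps diff_divide_distrib add_divide_distrib)
  finally show ?thesis .
qed

text \<open>Derandomized Hoeffding inequality. Bounding \<open>cosh\<close> by its chord makes the exponential
  potential an affine function of the next choice, so it suffices that every linear objective
  can be made nonpositive.\<close>
lemma exponential_potential_choice:
  fixes Z :: "nat \<Rightarrow> 'o \<Rightarrow> 'x \<Rightarrow> real"
  assumes "finite X"
    and lin: "\<And>i (c::'x \<Rightarrow> real). i < m \<Longrightarrow> \<exists>w\<in>Opt i. (\<Sum>x\<in>X. c x * Z i w x) \<le> 0"
    and bnd: "\<And>i w x. i < m \<Longrightarrow> w \<in> Opt i \<Longrightarrow> x \<in> X \<Longrightarrow> \<bar>Z i w x\<bar> \<le> b i x"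
  shows "\<exists>\<omega>. (\<forall>i<m. \<omega> i \<in> Opt i) \<and>
    (\<Sum>x\<in>X. exp (- (\<Sum>i<m. (\<kappa> * b i x)\<^sup>2) / 2) * cosh (\<kappa> * (\<Sum>i<m. Z i (\<omega> i) x))) \<le> real (card X)"
  using lin bnd
proof (induction m)
  case 0
  then show ?case by simp
next
  case (Suc m)
  obtain \<omega> where \<omega>: "\<forall>i<m. \<omega> i \<in> Opt i"
    "(\<Sum>x\<in>X. exp (- (\<Sum>i<m. (\<kappa> * b i x)\<^sup>2) / 2) * cosh (\<kappa> * (\<Sum>i<m. Z i (\<omega> i) x))) \<le> real (card X)"
  proof -
    have "\<exists>\<omega>. (\<forall>i<m. \<omega> i \<in> Opt i) \<and>
      (\<Sum>x\<in>X. exp (- (\<Sum>i<m. (\<kappa> * b i x)\<^sup>2) / 2) * cosh (\<kappa> * (\<Sum>i<m. Z i (\<omega> i) x))) \<le> real (card X)"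
    proof (rule Suc.IH)
      show "\<exists>w\<in>Opt i. (\<Sum>x\<in>X. c x * Z i w x) \<le> 0" if "i < m" for i and c :: "'x \<Rightarrow> real"
        using Suc.prems(1) less_SucI[OF that] by blast
      show "\<bar>Z i w x\<bar> \<le> b i x" if "i < m" "w \<in> Opt i" "x \<in> X" for i w x
        using Suc.prems(2) less_SucI[OF that(1)] that(2,3) by blast
    qed
    then show thesis using that by blast
  qed
  define S where "S x = \<kappa> * (\<Sum>i<m. Z i (\<omega> i) x)" for x
  define e where "e x = exp (- (\<Sum>i<m. (\<kappa> * b i x)\<^sup>2) / 2)" for x
  define q where "q x = exp (- (\<kappa> * b m x)\<^sup>2 / 2)" for x
  \<comment> \<open>The coefficient of \<open>Z m w x\<close> in the chord bound, including the
    discount \<open>e x * q x\<close>. If \<kappa> * b m x = 0 then \<kappa> * Z m w x = 0 and there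
    is no linear term. The absolute values are due to \<kappa> having arbitrary sign.\<close>
  define c where "c x = e x * q x * (if \<kappa> * b m x = 0 then 0 else
      sinh (S x) * (\<kappa> / \<bar>\<kappa> * b m x\<bar> * sinh \<bar>\<kappa> * b m x\<bar>))" for x
  obtain w where w: "w \<in> Opt m" "(\<Sum>x\<in>X. c x * Z m w x) \<le> 0" using Suc.prems(1) by blast
  have "e x * q x * cosh (S x + \<kappa> * Z m w x) \<le> e x * cosh (S x) + c x * Z m w x" if x: "x \<in> X" for x
  proof -
    \<comment> \<open>The exponential weights are in the potential for this purpose: the discount of
      step m pays for the growth factor cosh (\<kappa> * b m x).\<close>
    have q1: "q x * cosh (\<kappa> * b m x) \<le> 1"
      using cosh_le_exp_half_square[of "\<kappa> * b m x"] unfolding q_def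
      by (simp add: exp_minus field_simps)
    have Zb: "\<bar>\<kappa> * Z m w x\<bar> \<le> \<bar>\<kappa> * b m x\<bar>"
      using Suc.prems(2)[OF _ w(1) x] by (auto simp: abs_mult intro!: mult_left_mono)
    have eq: "e x > 0" "q x > 0" by (auto simp: e_def q_def)
    show ?thesis
    proof (cases "\<kappa> * b m x = 0")
      case True
      have "\<bar>\<kappa> * Z m w x\<bar> \<le> 0" using Zb unfolding True by simp
      then have "\<kappa> * Z m w x = 0" by linarith
      moreover have "q x = 1" "c x = 0" using True by (simp_all only: q_def c_def) auto
      ultimately show ?thesis by (simp only: add_0_right)
    next
      case False
      then have "cosh (S x + \<kappa> * Z m w x) \<le> cosh (S x) * cosh \<bar>\<kappa> * b m x\<bar>
          + sinh (S x) * (\<kappa> * Z m w x / \<bar>\<kappa> * b m x\<bar> * sinh \<bar>\<kappa> * b m x\<bar>)"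
        using Zb by (intro cosh_add_le_chord) auto
      then have "e x * q x * cosh (S x + \<kappa> * Z m w x) \<le> e x * q x * (cosh (S x) * cosh \<bar>\<kappa> * b m x\<bar>
          + sinh (S x) * (\<kappa> * Z m w x / \<bar>\<kappa> * b m x\<bar> * sinh \<bar>\<kappa> * b m x\<bar>))"
        using eq by (intro mult_left_mono) auto
      also have "\<dots> = e x * cosh (S x) * (q x * cosh (\<kappa> * b m x)) + c x * Z m w x"
        using False by (simp add: c_def algebra_simps)
      also have "e x * cosh (S x) * (q x * cosh (\<kappa> * b m x)) \<le> e x * cosh (S x) * 1"
        using q1 eq by (intro mult_left_mono) auto
      finally show ?thesis by simp
    qed
  qed
  then have "(\<Sum>x\<in>X. e x * q x * cosh (S x + \<kappa> * Z m w x)) \<le> (\<Sum>x\<in>X. e x * cosh (S x)) + (\<Sum>x\<in>X. c x * Z m w x)"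
    by (simp add: sum_mono flip: sum.distrib)
  also have "\<dots> \<le> real (card X)" using w(2) \<omega>(2) by (simp add: e_def S_def)
  finally have *: "(\<Sum>x\<in>X. e x * q x * cosh (S x + \<kappa> * Z m w x)) \<le> real (card X)" .
  define \<omega>' where "\<omega>' i = (if i = m then w else \<omega> i)" for i
  have "(\<Sum>x\<in>X. exp (- (\<Sum>i<Suc m. (\<kappa> * b i x)\<^sup>2) / 2) *
      cosh (\<kappa> * (\<Sum>i<Suc m. Z i (\<omega>' i) x))) =
      (\<Sum>x\<in>X. e x * q x * cosh (S x + \<kappa> * Z m w x))"
    by (intro sum.cong) (auto simp: \<omega>'_def e_def q_def S_def algebra_simps add_divide_distrib diff_divide_distrib simp flip: exp_add)
  with * show ?case using \<omega>(1) w(1) by (intro exI[of _ \<omega>']) (auto simp: \<omega>'_def less_Suc_eq)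
qed

lemma uniform_sign_balanced_choice:
  fixes Z :: "nat \<Rightarrow> 'o \<Rightarrow> 'x \<Rightarrow> real"
  assumes X: "finite X" "X \<noteq> {}"
    and lin: "\<And>i (c::'x \<Rightarrow> real). i < m \<Longrightarrow> \<exists>w\<in>Opt i. (\<Sum>x\<in>X. c x * Z i w x) \<le> 0"
    and bnd: "\<And>i w x. i < m \<Longrightarrow> w \<in> Opt i \<Longrightarrow> x \<in> X \<Longrightarrow> \<bar>Z i w x\<bar> \<le> b i x"
    and var: "\<And>x. x \<in> X \<Longrightarrow> (\<Sum>i<m. (b i x)\<^sup>2) \<le> V" and V: "V > 0"
  shows "\<exists>\<omega>. (\<forall>i<m. \<omega> i \<in> Opt i) \<and> 
    (\<forall>x\<in>X. \<bar>\<Sum>i<m. Z i (\<omega> i) x\<bar> \<le> sqrt (2 * V * ln (2 * real (card X))))"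
proof -
  define L where "L = ln (2 * real (card X))"
  have cX: "card X \<ge> 1" using X by (simp add: Suc_leI card_gt_0_iff)
  then have L: "L > 0" unfolding L_def by (intro ln_gt_zero) auto
  \<comment> \<open>Minimises L / \<kappa> + \<kappa> * V / 2, the bound on the sum that the
    potential yields; the minimum is sqrt (2 * V * L). The 2 inside the logarithm L pays for exp
    \<le> 2 * cosh.\<close>
  define \<kappa> where "\<kappa> = sqrt (2 * L / V)"
  have \<kappa>: "\<kappa> > 0" "\<kappa>\<^sup>2 = 2 * L / V" using L V by (auto simp: \<kappa>_def)
  obtain \<omega> where \<omega>: "\<forall>i<m. \<omega> i \<in> Opt i"
    "(\<Sum>x\<in>X. exp (- (\<Sum>i<m. (\<kappa> * b i x)\<^sup>2) / 2) * cosh (\<kappa> * (\<Sum>i<m. Z i (\<omega> i) x))) \<le> real (card X)"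
    using exponential_potential_choice[of X m Opt Z b \<kappa>, OF X(1) lin bnd] by blast
  have "\<bar>\<Sum>i<m. Z i (\<omega> i) x\<bar> \<le> sqrt (2 * V * L)" if x: "x \<in> X" for x
  proof -
    define s where "s = \<bar>\<Sum>i<m. Z i (\<omega> i) x\<bar>"
    have "(\<Sum>i<m. (\<kappa> * b i x)\<^sup>2) = \<kappa>\<^sup>2 * (\<Sum>i<m. (b i x)\<^sup>2)"
      by (simp add: power_mult_distrib sum_distrib_left)
    also have "\<dots> \<le> \<kappa>\<^sup>2 * V" using var[OF x] by (intro mult_left_mono) auto
    also have "\<dots> = 2 * L" using \<kappa> V by simp
    finally have le: "(\<Sum>i<m. (\<kappa> * b i x)\<^sup>2) \<le> 2 * L" .
    have sgn_free: "cosh (\<kappa> * s) = cosh (\<kappa> * (\<Sum>i<m. Z i (\<omega> i) x))"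
      unfolding s_def by (cases "(\<Sum>i<m. Z i (\<omega> i) x) \<ge> 0") (auto simp: abs_if)
    have "exp (- L) * cosh (\<kappa> * s) \<le> exp (- (\<Sum>i<m. (\<kappa> * b i x)\<^sup>2) / 2) * cosh (\<kappa> * s)"
      using le by (intro mult_right_mono) auto
    also have "\<dots> = exp (- (\<Sum>i<m. (\<kappa> * b i x)\<^sup>2) / 2) * cosh (\<kappa> * (\<Sum>i<m. Z i (\<omega> i) x))"
      by (simp only: sgn_free)
    also have "exp (- (\<Sum>i<m. (\<kappa> * b i x)\<^sup>2) / 2) * cosh (\<kappa> * (\<Sum>i<m. Z i (\<omega> i) x)) \<le>
        (\<Sum>x\<in>X. exp (- (\<Sum>i<m. (\<kappa> * b i x)\<^sup>2) / 2) * cosh (\<kappa> * (\<Sum>i<m. Z i (\<omega> i) x)))"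
      using X x by (intro member_le_sum) auto
    also note \<omega>(2)
    finally have "cosh (\<kappa> * s) \<le> card X * exp L" by (simp add: exp_minus field_simps)
    moreover have "exp (\<kappa> * s) \<le> 2 * cosh (\<kappa> * s)" by (simp add: cosh_field_def)
    moreover have "2 * real (card X) = exp L" using cX by (simp add: L_def)
    moreover have "2 * (real (card X) * exp L) = exp L * exp L"
      using calculation(3) by (simp only: mult.assoc[symmetric])
    ultimately have "exp (\<kappa> * s) \<le> exp L * exp L" by linarith
    then have "exp (\<kappa> * s) \<le> exp (L + L)" by (simp only: exp_add)
    then have "\<kappa> * s \<le> L + L" by (simp only: exp_le_cancel_iff)
    also have "L + L = 2 * L" by simp
    also have "2 * L = \<kappa> * sqrt (2 * V * L)"
    proof -
      have "\<kappa> * sqrt (2 * V * L) = sqrt ((2 * L)\<^sup>2)"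
        unfolding \<kappa>_def real_sqrt_mult[symmetric] using V by (simp add: power2_eq_square)
      then show ?thesis using L by (simp only: real_sqrt_abs)
    qed
    finally show ?thesis using \<kappa> by (simp add: s_def)
  qed
  then show ?thesis using \<omega>(1) by (auto simp: L_def)
qed

section \<open>Packing for annularly regular measures\<close>

lemma
  assumes "is_norm N"
  shows is_norm_nonneg: "0 \<le> N x"
    and is_norm_zero: "N 0 = 0"
    and is_norm_commute: "N (x - y) = N (y - x)"
    and is_norm_triangle: "N (x - z) \<le> N (x - y) + N (y - z)"
    and is_norm_abs_diff: "\<bar>N x - N y\<bar> \<le> N (x - y)"
proof -
  show "0 \<le> N x" "N 0 = 0" for x using assms by (auto simp: is_norm_def)
  have add: "N (x + y) \<le> N x + N y" for x y using assms by (auto simp: is_norm_def)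
  have "N (- 1 *\<^sub>R x) = \<bar>- 1\<bar> * N x" for x using assms unfolding is_norm_def by blast
  then have m: "N (- x) = N x" for x by simp
  show com: "N (x - y) = N (y - x)" for x y using m[of "x - y"] by simp
  show "N (x - z) \<le> N (x - y) + N (y - z)" using add[of "x - y" "y - z"] by simp
  show "\<bar>N x - N y\<bar> \<le> N (x - y)" using add[of "x - y" y] add[of "y - x" x] com[of x y] by simp
qed

lemma is_norm_continuous:
  fixes N :: "'a::euclidean_space \<Rightarrow> real"
  assumes "is_norm N"
  shows "continuous_on A N"
proof -
  obtain a b where b: "b > 0" "\<And>x. N x \<le> b * norm x"
    using is_norm_equivalent[OF assms] by metis
  have "b-lipschitz_on A N"
    using b is_norm_abs_diff[OF assms]
    by (intro lipschitz_onI) (auto simp: dist_norm intro: order.trans)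
  then show ?thesis by (rule lipschitz_on_continuous_on)
qed

definition separated :: "('a::real_vector \<Rightarrow> real) \<Rightarrow> real \<Rightarrow> 'a set \<Rightarrow> bool" where
  "separated N h X \<longleftrightarrow> (\<forall>x\<in>X. \<forall>x'\<in>X. x \<noteq> x' \<longrightarrow> h \<le> N (x - x'))"

text \<open>The constants c4, c5 and \<beta> are parameters, and the bounds below are explicit
  expressions in them and in the data of the kernel. Uniformity in N, \<Omega> and \<mu> then comes
  from interpreting the locale after the final constant has been fixed.\<close>

locale annular_regular = prob_space \<mu>
  for \<mu> :: "'a::euclidean_space measure" +
  fixes N :: "'a \<Rightarrow> real" and \<Omega> :: "'a set" and c4 c5 \<beta> :: real
  assumes norm: "is_norm N"
    and params: "c4 > 1" "\<beta> \<ge> 1" "c5 > 0"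
    and compact: "compact \<Omega>" and unit: "\<Omega> \<subseteq> ncball N 0 1"
    and sets_\<mu>: "sets \<mu> = sets borel" and support: "emeasure \<mu> (- \<Omega>) = 0"
    and lower: "\<And>x \<delta>. x \<in> \<Omega> \<Longrightarrow> 0 < \<delta> \<Longrightarrow> \<delta> \<le> 2 \<Longrightarrow> inverse c4 * \<delta> powr \<beta> \<le> measure \<mu> (nball N x \<delta>)"
    and upper: "\<And>x \<delta>. x \<in> \<Omega> \<Longrightarrow> 0 < \<delta> \<Longrightarrow> \<delta> \<le> 2 \<Longrightarrow> measure \<mu> (nball N x \<delta>) \<le> c4 * \<delta> powr \<beta>"
    and shell: "\<And>x u s. x \<in> \<Omega> \<Longrightarrow> 0 < u \<Longrightarrow> u \<le> 2 \<Longrightarrow> 0 < s \<Longrightarrow> s \<le> 2 \<Longrightarrow>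
      measure \<mu> {y\<in>\<Omega>. u \<le> N (y - x) \<and> N (y - x) \<le> u + s} \<le> c5 * s"
begin

lemmas N_nonneg = is_norm_nonneg[OF norm]
lemmas N_zero = is_norm_zero[OF norm]
lemmas N_commute = is_norm_commute[OF norm]
lemmas N_triangle = is_norm_triangle[OF norm]

lemma N_diff_le_shift: "N (x - y) \<le> N (x - z) + N (y - z)"
  using N_triangle[of x y z] N_commute[of y z] by simp

lemma N_abs_diff: "\<bar>N (x - y) - N (x - z)\<bar> \<le> N (y - z)"
  using N_diff_le_shift[of x y z] N_diff_le_shift[of x z y] N_triangle[of x y z] N_triangle[of x z y]
    N_commute[of y z] by linarith

lemma N_abs_diff': "\<bar>N (y - x) - N (z - x)\<bar> \<le> N (y - z)"
  using N_abs_diff[of x y z] N_commute[of x y] N_commute[of x z] by simp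

lemma diameter: "x \<in> \<Omega> \<Longrightarrow> y \<in> \<Omega> \<Longrightarrow> N (x - y) \<le> 2"
proof -
  assume "x \<in> \<Omega>" "y \<in> \<Omega>"
  then have "N (0 - x) \<le> 1" "N (0 - y) \<le> 1" using unit by (auto simp: ncball_def)
  then show ?thesis using N_triangle[of x y 0] N_commute[of x 0] by simp
qed

lemma space_\<mu>: "space \<mu> = UNIV"
  using sets_eq_imp_space_eq[OF sets_\<mu>] by simp

lemma \<Omega>_measurable: "\<Omega> \<in> sets \<mu>"
  using compact by (simp add: sets_\<mu> compact_imp_closed)

lemma nball_measurable: "nball N x r \<in> sets \<mu>"
proof -
  have "open {y. N (x - y) < r}"
    by (intro open_Collect_less continuous_on_compose2[OF is_norm_continuous[OF norm, of UNIV]]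
        continuous_intros) auto
  then show ?thesis by (simp add: nball_def sets_\<mu>)
qed

lemma shell_measurable: "{y\<in>\<Omega>. \<bar>N (y - x) - t\<bar> \<le> e} \<in> sets \<mu>"
proof -
  have "closed {y. \<bar>N (y - x) - t\<bar> \<le> e}"
    by (intro closed_Collect_le continuous_intros
        continuous_on_compose2[OF is_norm_continuous[OF norm, of UNIV]]) auto
  then have "closed (\<Omega> \<inter> {y. \<bar>N (y - x) - t\<bar> \<le> e})"
    using compact_imp_closed[OF compact] by (intro closed_Int)
  moreover have "\<Omega> \<inter> {y. \<bar>N (y - x) - t\<bar> \<le> e} = {y\<in>\<Omega>. \<bar>N (y - x) - t\<bar> \<le> e}" by blast
  ultimately show ?thesis unfolding sets_\<mu> by simp
qed

lemma measure_Int_\<Omega>: "A \<in> sets \<mu> \<Longrightarrow> measure \<mu> (A \<inter> \<Omega>) = measure \<mu> A"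
proof -
  assume A: "A \<in> sets \<mu>"
  have "- \<Omega> \<in> null_sets \<mu>" using support \<Omega>_measurable space_\<mu>
    by (metis Compl_eq_Diff_UNIV null_setsI sets.compl_sets)
  then have "measure \<mu> (A - (- \<Omega>)) = measure \<mu> A" using A by (intro measure_Diff_null_set)
  then show ?thesis by (simp add: Diff_eq)
qed

lemma \<Omega>_nonempty: "\<Omega> \<noteq> {}"
  using measure_Int_\<Omega>[of "space \<mu>"] prob_space by auto

text \<open>Balls of radius h/2 about h-separated points are disjoint, and \<open>lower\<close>
  bounds the mass of each from below; h \<le> 4 keeps the radius in the range of
  \<open>lower\<close>. The set A is left free: the whole space yields net sizes, a thickened shell
  yields the number of cells near a sphere.\<close>

lemma packing:
  assumes X: "finite X" "X \<subseteq> \<Omega>" "separated N h X" and h: "0 < h" "h \<le> 4"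
    and A: "A \<in> sets \<mu>" "\<And>x. x \<in> X \<Longrightarrow> nball N x (h / 2) \<inter> \<Omega> \<subseteq> A"
  shows "real (card X) \<le> c4 * (2 / h) powr \<beta> * measure \<mu> A"
proof -
  have disj: "disjoint_family_on (\<lambda>x. nball N x (h / 2) \<inter> \<Omega>) X"
    unfolding disjoint_family_on_def
  proof (intro ballI impI)
    fix x x' assume "x \<in> X" "x' \<in> X" "x \<noteq> x'"
    then have "h \<le> N (x - x')" using X by (auto simp: separated_def)
    moreover have "N (x - x') < h" if "N (x - y) < h / 2" "N (x' - y) < h / 2" for y
      using N_diff_le_shift[of x x' y] that by simp
    ultimately show "nball N x (h / 2) \<inter> \<Omega> \<inter> (nball N x' (h / 2) \<inter> \<Omega>) = {}"
      by (force simp: nball_def)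
  qed
  have "real (card X) * (inverse c4 * (h / 2) powr \<beta>) = (\<Sum>x\<in>X. inverse c4 * (h / 2) powr \<beta>)" by simp
  also have "\<dots> \<le> (\<Sum>x\<in>X. measure \<mu> (nball N x (h / 2) \<inter> \<Omega>))"
    using X h lower[of _ "h / 2"] by (intro sum_mono) (auto simp: measure_Int_\<Omega> nball_measurable)
  also have "\<dots> = measure \<mu> (\<Union>x\<in>X. nball N x (h / 2) \<inter> \<Omega>)"
    using X disj \<Omega>_measurable nball_measurable by (intro finite_measure_finite_Union[symmetric]) auto
  also have "\<dots> \<le> measure \<mu> A"
    using A by (intro finite_measure_mono) auto
  finally have le: "real (card X) * (inverse c4 * (h / 2) powr \<beta>) \<le> measure \<mu> A" .
  have "(2 / h) powr \<beta> * (h / 2) powr \<beta> = 1"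
    using h by (simp flip: powr_mult)
  moreover have "c4 * (2 / h) powr \<beta> * (real (card X) * (inverse c4 * (h / 2) powr \<beta>))
      = real (card X) * ((2 / h) powr \<beta> * (h / 2) powr \<beta>)" using params by simp
  ultimately have "real (card X) = c4 * (2 / h) powr \<beta> * (real (card X) * (inverse c4 * (h / 2) powr \<beta>))"
    by simp
  also have "\<dots> \<le> c4 * (2 / h) powr \<beta> * measure \<mu> A"
    using le params by (intro mult_left_mono) auto
  finally show ?thesis .
qed

text \<open>A separated set of largest cardinality is a net, for an uncovered point could be added
  to it. The packing bound ensures that a largest one exists.\<close>

lemma net_exists:
  assumes h: "0 < h" "h \<le> 4"
  obtains X where "finite X" "X \<subseteq> \<Omega>" "separated N h X" "real (card X) \<le> c4 * (2 / h) powr \<beta>"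
    "\<And>y. y \<in> \<Omega> \<Longrightarrow> \<exists>x\<in>X. N (y - x) < h"
proof -
  define Q where "Q X \<longleftrightarrow> finite X \<and> X \<subseteq> \<Omega> \<and> separated N h X" for X
  have bound: "real (card X) \<le> c4 * (2 / h) powr \<beta>" if "Q X" for X
    using packing[of X h "space \<mu>"] that h prob_space sets.top[of \<mu>]
    by (auto simp: Q_def space_\<mu>)
  have "Q {}" by (simp add: Q_def separated_def)
  moreover have "\<forall>X. Q X \<longrightarrow> card X < nat \<lceil>c4 * (2 / h) powr \<beta>\<rceil> + 1"
    using bound by (metis less_add_one le_imp_less_Suc Suc_eq_plus1 of_nat_le_iff order.trans real_nat_ceiling_ge)
  ultimately obtain X where X: "Q X" "\<And>X'. Q X' \<Longrightarrow> card X' \<le> card X"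
    using ex_has_greatest_nat[of Q "{}" card] by blast
  have "\<exists>x\<in>X. N (y - x) < h" if y: "y \<in> \<Omega>" for y
  proof (rule ccontr)
    assume *: "\<not> ?thesis"
    then have "y \<notin> X" using N_zero h by force
    moreover have "Q (insert y X)"
      using X(1) y * N_commute[of y] by (auto simp: Q_def separated_def not_less)
    ultimately show False using X(2)[of "insert y X"] X(1) by (simp add: Q_def)
  qed
  then show thesis using that X(1) bound by (auto simp: Q_def)
qed

text \<open>One summand for each case of \<open>shell_measure\<close>: hypothesis (ii) when the
  shell stays away from its centre; a ball of radius 3e when t \<le> e, where the inner radius t - e
  would not be positive as (ii) demands; the trivial bound 1 \<le> 2e when e \<ge> 1/2.\<close>

definition shell_const :: real where
  "shell_const = 2 * c5 + c4 * 3 powr \<beta> + 2"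

lemma shell_const_pos: "shell_const > 0"
proof -
  have "0 \<le> c4 * 3 powr \<beta>" using params by simp
  then show ?thesis using params unfolding shell_const_def by linarith
qed

lemma shell_measure:
  assumes x: "x \<in> \<Omega>" and t: "0 \<le> t" "t \<le> 2" and e: "0 < e"
  shows "measure \<mu> {y\<in>\<Omega>. \<bar>N (y - x) - t\<bar> \<le> e} \<le> shell_const * e"
proof -
  have pos: "0 \<le> c5 * e" "0 \<le> c4 * 3 powr \<beta> * e" using params e by auto
  have sc: "shell_const * e = 2 * (c5 * e) + c4 * 3 powr \<beta> * e + 2 * e"
    by (simp add: shell_const_def algebra_simps)
  consider "e \<ge> 1/2" | "e < 1/2" "t > e" | "e < 1/2" "t \<le> e" by linarith
  then show ?thesis
  proof cases
    case 1
    then have "measure \<mu> {y\<in>\<Omega>. \<bar>N (y - x) - t\<bar> \<le> e} \<le> 2 * e"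
      by (intro order.trans[OF prob_le_1]) simp
    then show ?thesis using pos sc by linarith
  next
    case 2
    have "{y\<in>\<Omega>. \<bar>N (y - x) - t\<bar> \<le> e} = {y\<in>\<Omega>. t - e \<le> N (y - x) \<and> N (y - x) \<le> (t - e) + 2 * e}"
      by auto
    also have "measure \<mu> \<dots> \<le> c5 * (2 * e)" using 2 e t x by (intro shell) auto
    finally show ?thesis using pos sc e by linarith
  next
    case 3
    have "{y\<in>\<Omega>. \<bar>N (y - x) - t\<bar> \<le> e} \<subseteq> nball N x (3 * e)"
      using 3 e N_commute[of x] by (auto simp: nball_def)
    then have "measure \<mu> {y\<in>\<Omega>. \<bar>N (y - x) - t\<bar> \<le> e} \<le> measure \<mu> (nball N x (3 * e))"
      by (intro finite_measure_mono nball_measurable)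
    also have "\<dots> \<le> c4 * (3 * e) powr \<beta>" using 3 e x by (intro upper) auto
    also have "(3 * e) powr \<beta> = 3 powr \<beta> * e powr \<beta>" using e by (simp add: powr_mult)
    also have "e powr \<beta> \<le> e powr 1" using e 3 params by (intro powr_mono') auto
    finally have "measure \<mu> {y\<in>\<Omega>. \<bar>N (y - x) - t\<bar> \<le> e} \<le> c4 * (3 powr \<beta> * e)"
      using params e by (auto simp: mult_left_mono)
    then show ?thesis using pos sc e by (simp add: algebra_simps)
  qed
qed

text \<open>With T the kink radii and \<rho> comparable to h, this is h^(-\<beta>) times the measure
  of shells of thickness about h, hence of order h^(1-\<beta>). Thickening the shells by h makes
  them contain the packing balls.\<close>

lemma shell_count:
  assumes x: "x \<in> \<Omega>" and Y: "finite Y" "Y \<subseteq> \<Omega>" "separated N h Y" and h: "0 < h" "h \<le> 4"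
    and T: "finite T" "T \<subseteq> {0..2}" and \<rho>: "0 \<le> \<rho>"
  shows "real (card {c\<in>Y. \<exists>t\<in>T. \<bar>N (x - c) - t\<bar> \<le> \<rho>})
    \<le> c4 * (2 / h) powr \<beta> * (real (card T) * (shell_const * (\<rho> + h)))"
proof -
  define A where "A = (\<Union>t\<in>T. {y\<in>\<Omega>. \<bar>N (y - x) - t\<bar> \<le> \<rho> + h})"
  have A: "A \<in> sets \<mu>" unfolding A_def using T shell_measurable by auto
  have "real (card {c\<in>Y. \<exists>t\<in>T. \<bar>N (x - c) - t\<bar> \<le> \<rho>}) \<le> c4 * (2 / h) powr \<beta> * measure \<mu> A"
  proof (rule packing[OF _ _ _ h A])
    fix c assume "c \<in> {c\<in>Y. \<exists>t\<in>T. \<bar>N (x - c) - t\<bar> \<le> \<rho>}"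
    then obtain t where t: "t \<in> T" "\<bar>N (x - c) - t\<bar> \<le> \<rho>" by auto
    have "\<bar>N (y - x) - t\<bar> \<le> \<rho> + h" if "N (c - y) < h / 2" for y
      using N_abs_diff[of x c y] N_commute[of y x] that t h by linarith
    then show "nball N c (h / 2) \<inter> \<Omega> \<subseteq> A" using t(1) by (auto simp: A_def nball_def)
  qed (use Y in \<open>auto simp: separated_def\<close>)
  also have "measure \<mu> A \<le> (\<Sum>t\<in>T. measure \<mu> {y\<in>\<Omega>. \<bar>N (y - x) - t\<bar> \<le> \<rho> + h})"
    unfolding A_def using T shell_measurable by (intro finite_measure_subadditive_finite) auto
  also have "\<dots> \<le> (\<Sum>t\<in>T. shell_const * (\<rho> + h))"
    using T \<rho> h x by (intro sum_mono shell_measure) auto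
  finally show ?thesis using params by (simp add: mult_left_mono)
qed

text \<open>The substitute for a bound on the density of g: if every cell carries at most 1/\<nu>,
  the mass near the kink spheres is at most 1/\<nu> times the number of cells there. Replacing y by
  its centre \<open>c y\<close> costs one h and \<open>shell_count\<close> a second one, whence
  \<rho> + 2 * h.\<close>

lemma shell_mass:
  assumes x: "x \<in> \<Omega>" and Y: "finite Y" "Y \<subseteq> \<Omega>" "separated N h Y" and h: "0 < h" "h \<le> 4"
    and T: "finite T" "T \<subseteq> {0..2}" and \<rho>: "0 \<le> \<rho>" and R: "finite R"
    and c: "\<And>y. y \<in> R \<Longrightarrow> c y \<in> Y" "\<And>y. y \<in> R \<Longrightarrow> N (y - c y) \<le> h"
    and u: "\<And>y. 0 \<le> u y" and light: "\<And>z. sum u {y\<in>R. c y = z} \<le> 1 / \<nu>" and \<nu>: "\<nu> > 0"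
  shows "sum u {y\<in>R. \<exists>t\<in>T. \<bar>N (x - y) - t\<bar> \<le> \<rho>}
    \<le> c4 * (2 / h) powr \<beta> * (real (card T) * (shell_const * (\<rho> + 2 * h))) / \<nu>"
proof -
  define Y' where "Y' = {c\<in>Y. \<exists>t\<in>T. \<bar>N (x - c) - t\<bar> \<le> \<rho> + h}"
  have Y': "finite Y'" using Y by (simp add: Y'_def)
  have "{y\<in>R. \<exists>t\<in>T. \<bar>N (x - y) - t\<bar> \<le> \<rho>} \<subseteq> (\<Union>z\<in>Y'. {y\<in>R. c y = z})"
  proof
    fix y assume "y \<in> {y\<in>R. \<exists>t\<in>T. \<bar>N (x - y) - t\<bar> \<le> \<rho>}"
    then obtain t where t: "y \<in> R" "t \<in> T" "\<bar>N (x - y) - t\<bar> \<le> \<rho>" by auto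
    have "\<bar>N (x - c y) - t\<bar> \<le> \<rho> + h" using N_abs_diff[of x y "c y"] c(2)[OF t(1)] t(3) by linarith
    then show "y \<in> (\<Union>z\<in>Y'. {y\<in>R. c y = z})" using t c(1) by (auto simp: Y'_def)
  qed
  then have "sum u {y\<in>R. \<exists>t\<in>T. \<bar>N (x - y) - t\<bar> \<le> \<rho>} \<le> sum u (\<Union>z\<in>Y'. {y\<in>R. c y = z})"
    using R Y' u by (intro sum_mono2) auto
  also have "\<dots> = (\<Sum>z\<in>Y'. sum u {y\<in>R. c y = z})"
    using R Y' by (intro sum.UNION_disjoint) auto
  also have "\<dots> \<le> (\<Sum>z\<in>Y'. 1 / \<nu>)" by (intro sum_mono light)
  also have "\<dots> = real (card Y') * (1 / \<nu>)" by simp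
  also have "\<dots> \<le> c4 * (2 / h) powr \<beta> * (real (card T) * (shell_const * (\<rho> + h + h))) * (1 / \<nu>)"
    unfolding Y'_def using shell_count[OF x Y h T, of "\<rho> + h"] \<rho> h \<nu> by (intro mult_right_mono) auto
  also have "\<rho> + h + h = \<rho> + 2 * h" by simp
  finally show ?thesis by simp
qed

end

section \<open>Multiscale decomposition of point weights\<close>

text \<open>The fibres of c are the cells of a net, R' is the remainder handed on to a coarser
  scale, and \<open>ps\<close> decomposes u on R - R'. It is a list because a heavy cell contributes
  several equal pieces.\<close>

definition fibre_pieces ::
  "('a \<Rightarrow> 'b) \<Rightarrow> real \<Rightarrow> ('a \<Rightarrow> real) \<Rightarrow> 'a set \<Rightarrow> 'a set \<Rightarrow> ('a \<Rightarrow> real) list \<Rightarrow> bool" where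
  "fibre_pieces c \<nu> u R R' ps \<longleftrightarrow> R' \<subseteq> R \<and>
     (\<forall>U\<in>set ps. (\<forall>y. 0 \<le> U y \<and> (U y \<noteq> 0 \<longrightarrow> y \<in> R - R')) \<and>
        (\<forall>y y'. U y \<noteq> 0 \<longrightarrow> U y' \<noteq> 0 \<longrightarrow> c y = c y') \<and> sum U R \<le> 1 / \<nu>) \<and>
     (\<forall>y. (\<Sum>U\<leftarrow>ps. U y) = (if y \<in> R - R' then u y else 0))"

text \<open>A fibre of mass m > 1/\<nu> is removed as a whole and cut into k equal multiples of
  itself, where rounding up gives k \<le> 2 * \<nu> * m because \<nu> * m > 1. Since pieces are
  charged to the mass that they remove, the counts add up over the scales to at most 2 * \<nu>,
  however many scales there are.\<close>

lemma split_heavy_fibres: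
  assumes "finite R" "\<And>y. 0 \<le> u y" and \<nu>: "\<nu> > 0"
  shows "\<exists>ps R'. fibre_pieces c \<nu> u R R' ps \<and> real (length ps) \<le> 2 * \<nu> * sum u (R - R') \<and>
    (\<forall>z. sum u {y\<in>R'. c y = z} \<le> 1 / \<nu>)"
  using assms(1)
proof (induction "card R" arbitrary: R rule: less_induct)
  case less
  show ?case
  proof (cases "\<forall>z. sum u {y\<in>R. c y = z} \<le> 1 / \<nu>")
    case True
    then show ?thesis by (intro exI[of _ "[]"] exI[of _ R]) (auto simp: fibre_pieces_def)
  next
    case False
    then obtain z where z: "sum u {y\<in>R. c y = z} > 1 / \<nu>" by (auto simp: not_le)
    define F where "F = {y\<in>R. c y = z}"
    define m where "m = sum u F"
    define k where "k = nat \<lceil>\<nu> * m\<rceil>"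
    have m: "m > 1 / \<nu>" using z by (simp add: m_def F_def)
    then have \<nu>m: "\<nu> * m > 1" using \<nu> by (simp add: field_simps)
    then have k: "real k \<ge> \<nu> * m" "real k \<le> 2 * \<nu> * m" "real k > 0"
      unfolding k_def using of_nat_ceiling[of "\<nu> * m"] by linarith+
    define U0 where "U0 y = (if y \<in> F then u y / real k else 0)" for y
    have F: "finite F" "F \<subseteq> R" using less.prems by (auto simp: F_def)
    have "F \<noteq> {}" using m \<nu> by (auto simp: m_def)
    then have "card (R - F) < card R" using F less.prems by (intro psubset_card_mono) auto
    then obtain ps R' where IH: "fibre_pieces c \<nu> u (R - F) R' ps"
      "real (length ps) \<le> 2 * \<nu> * sum u (R - F - R')" "\<forall>z. sum u {y\<in>R'. c y = z} \<le> 1 / \<nu>"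
      using less.hyps[of "R - F"] less.prems by auto
    have R': "R' \<subseteq> R - F" using IH(1) by (simp add: fibre_pieces_def)
    have sumR: "sum u (R - R') = m + sum u (R - F - R')"
    proof -
      have "R - R' = F \<union> (R - F - R')" using R' F by auto
      then show ?thesis unfolding m_def using F less.prems sum.union_disjoint[of F "R - F - R'" u] by auto
    qed
    have "sum U0 R = sum U0 F"
      using F less.prems by (intro sum.mono_neutral_right) (auto simp: U0_def)
    also have "\<dots> = m / real k" by (simp add: U0_def m_def sum_divide_distrib)
    also have "\<dots> \<le> 1 / \<nu>" using k \<nu> by (simp add: field_simps)
    finally have U0m: "sum U0 R \<le> 1 / \<nu>" .
    have U0: "0 \<le> U0 y" for y using assms(2) by (simp add: U0_def)
    have old: "sum U R \<le> 1 / \<nu>" if "U \<in> set ps" for U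
    proof -
      have "sum U R = sum U (R - F)"
        using that IH(1) F less.prems by (intro sum.mono_neutral_right) (auto simp: fibre_pieces_def)
      then show ?thesis using that IH(1) by (auto simp: fibre_pieces_def)
    qed
    have new_ok: "(\<forall>y. 0 \<le> U0 y \<and> (U0 y \<noteq> 0 \<longrightarrow> y \<in> R - R')) \<and>
        (\<forall>y y'. U0 y \<noteq> 0 \<longrightarrow> U0 y' \<noteq> 0 \<longrightarrow> c y = c y') \<and> sum U0 R \<le> 1 / \<nu>"
    proof -
      have supp: "y \<in> F" if "U0 y \<noteq> 0" for y
        using that by (simp add: U0_def split: if_splits)
      then have "y \<in> R - R'" "c y = z" if "U0 y \<noteq> 0" for y
        using that R' supp[OF that] by (auto simp: F_def)
      then show ?thesis using U0 U0m by auto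
    qed
    have old_ok: "(\<forall>y. 0 \<le> U y \<and> (U y \<noteq> 0 \<longrightarrow> y \<in> R - R')) \<and>
        (\<forall>y y'. U y \<noteq> 0 \<longrightarrow> U y' \<noteq> 0 \<longrightarrow> c y = c y') \<and> sum U R \<le> 1 / \<nu>" if "U \<in> set ps" for U
      using IH(1) that old[OF that] unfolding fibre_pieces_def by blast
    have old_sum: "(\<Sum>U\<leftarrow>ps. U y) = (if y \<in> R - F - R' then u y else 0)" for y
      using IH(1) by (simp add: fibre_pieces_def)
    have "(\<Sum>U\<leftarrow>replicate k U0 @ ps. U y) = real k * U0 y + (if y \<in> R - F - R' then u y else 0)" for y
      by (simp add: old_sum sum_list_replicate)
    also have "real k * U0 y + (if y \<in> R - F - R' then u y else 0) = (if y \<in> R - R' then u y else 0)" for y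
      using k(3) R' F(2) by (auto simp: U0_def)
    finally have sums: "(\<Sum>U\<leftarrow>replicate k U0 @ ps. U y) = (if y \<in> R - R' then u y else 0)" for y .
    have all_ok: "\<forall>U\<in>set (replicate k U0 @ ps). (\<forall>y. 0 \<le> U y \<and> (U y \<noteq> 0 \<longrightarrow> y \<in> R - R')) \<and>
        (\<forall>y y'. U y \<noteq> 0 \<longrightarrow> U y' \<noteq> 0 \<longrightarrow> c y = c y') \<and> sum U R \<le> 1 / \<nu>"
    proof
      fix U assume "U \<in> set (replicate k U0 @ ps)"
      then consider "U = U0" | "U \<in> set ps" by (auto split: if_splits)
      then show "(\<forall>y. 0 \<le> U y \<and> (U y \<noteq> 0 \<longrightarrow> y \<in> R - R')) \<and>
        (\<forall>y y'. U y \<noteq> 0 \<longrightarrow> U y' \<noteq> 0 \<longrightarrow> c y = c y') \<and> sum U R \<le> 1 / \<nu>"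
        by cases (use new_ok old_ok in blast)+
    qed
    have "R' \<subseteq> R" using R' by blast
    then have "fibre_pieces c \<nu> u R R' (replicate k U0 @ ps)"
      unfolding fibre_pieces_def by (intro conjI allI all_ok sums)
    moreover have "real (length (replicate k U0 @ ps)) \<le> 2 * \<nu> * sum u (R - R')"
      using k(2) IH(2) unfolding sumR distrib_left length_append length_replicate of_nat_add by linarith
    ultimately show ?thesis using IH(3) by blast
  qed
qed

text \<open>For the coarsest scale, where few cells remain: one piece per cell, counted by the
  number of cells instead of by their mass.\<close>

lemma light_fibres_pieces:
  assumes "finite R" "\<And>y. 0 \<le> u y" and light: "\<And>z. sum u {y\<in>R. c y = z} \<le> 1 / \<nu>"
  shows "\<exists>ps. fibre_pieces c \<nu> u R {} ps \<and> length ps \<le> card (c ` R)"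
proof -
  obtain zs where zs: "set zs = c ` R" "distinct zs"
    using finite_distinct_list[OF finite_imageI[OF assms(1)], of c] by blast
  define U where "U z y = (if y \<in> R \<and> c y = z then u y else 0)" for z y
  have "sum (U z) R \<le> 1 / \<nu>" for z
  proof -
    have "sum (U z) R = sum (U z) {y\<in>R. c y = z}"
      using assms(1) by (intro sum.mono_neutral_right) (auto simp: U_def)
    also have "\<dots> = sum u {y\<in>R. c y = z}" by (intro sum.cong) (auto simp: U_def)
    finally show ?thesis using light by simp
  qed
  moreover have "(\<Sum>z\<leftarrow>zs. U z y) = (if y \<in> R then u y else 0)" for y
  proof -
    have "(\<Sum>z\<leftarrow>zs. U z y) = (\<Sum>z\<in>c ` R. U z y)"
      using zs by (simp add: sum_list_distinct_conv_sum_set)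
    also have "\<dots> = (\<Sum>z\<in>c ` R. if z = c y then (if y \<in> R then u y else 0) else 0)"
      by (intro sum.cong) (auto simp: U_def)
    also have "\<dots> = (if y \<in> R then u y else 0)" using assms(1) by (simp add: sum.delta)
    finally show ?thesis .
  qed
  ultimately have "fibre_pieces c \<nu> u R {} (map U zs)"
    using assms(2) by (auto simp: fibre_pieces_def U_def o_def split: if_splits)
  moreover have "length (map U zs) = card (c ` R)" using zs by (metis distinct_card length_map)
  ultimately show ?thesis by (metis order.refl)
qed

section \<open>Pieces that cross a kink sphere, and the sum of their squared errors\<close>

context annular_regular
begin

text \<open>Here d will bound the diameter of the support of U. A piece with points on both sides of
  the sphere of radius t has points within d of it, so a piece that does not cross lies in a single
  shell between consecutive kink radii.\<close>

definition crosses :: "real set \<Rightarrow> 'a \<Rightarrow> ('a \<Rightarrow> real) \<Rightarrow> real \<Rightarrow> bool" where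
  "crosses T x U d \<longleftrightarrow> (\<exists>t\<in>T. \<exists>y. U y \<noteq> 0 \<and> \<bar>N (x - y) - t\<bar> \<le> d)"

text \<open>A quarter of the variance proxy in the Hoeffding argument: compressing a piece of
  diameter d and mass m changes the sum at x by at most 2 * d * m if the piece crosses, and not at
  all otherwise.\<close>

definition crossing_var :: "real set \<Rightarrow> 'a set \<Rightarrow> 'a \<Rightarrow> (('a \<Rightarrow> real) \<times> real) list \<Rightarrow> real" where
  "crossing_var T S x qs = (\<Sum>(U, d)\<leftarrow>qs. if crosses T x U d then (d * sum U S)\<^sup>2 else 0)"

lemma fibre_pieces_diameter:
  assumes "fibre_pieces c \<nu> u R R' ps" "\<And>y. y \<in> R \<Longrightarrow> N (y - c y) \<le> h"
    and "U \<in> set ps" "U y \<noteq> 0" "U y' \<noteq> 0"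
  shows "N (y - y') \<le> 2 * h"
proof -
  have "y \<in> R" "y' \<in> R" "c y = c y'" using assms unfolding fibre_pieces_def by blast+
  then show ?thesis using N_diff_le_shift[of y y' "c y"] assms(2)[of y] assms(2)[of y'] by simp
qed

text \<open>In each square one factor of mass is bounded by 1/\<nu> and the other is summed. A
  crossing piece has a point within 2h of a kink sphere and diameter at most 2h, so all its mass
  lies within 4h; there the pieces together have no more mass than u.\<close>

lemma crossing_var_fibre_pieces:
  assumes fp: "fibre_pieces c \<nu> u R R' ps" and c: "\<And>y. y \<in> R \<Longrightarrow> N (y - c y) \<le> h"
    and fin: "finite S" and R: "R \<subseteq> S" and u: "\<And>y. 0 \<le> u y" and \<nu>: "\<nu> > 0" and h: "h > 0"
  shows "crossing_var T S x (map (\<lambda>U. (U, 2 * h)) ps)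
    \<le> 4 * h\<^sup>2 / \<nu> * sum u {y\<in>R. \<exists>t\<in>T. \<bar>N (x - y) - t\<bar> \<le> 4 * h}"
proof -
  define A where "A = {y\<in>R. \<exists>t\<in>T. \<bar>N (x - y) - t\<bar> \<le> 4 * h}"
  have A: "finite A" "A \<subseteq> S" using fin R finite_subset[OF R] by (auto simp: A_def)
  have each: "(if crosses T x U (2 * h) then (2 * h * sum U S)\<^sup>2 else 0) \<le> 4 * h\<^sup>2 / \<nu> * sum U A"
    if U: "U \<in> set ps" for U
  proof -
    have U0: "0 \<le> U y" and supp: "U y \<noteq> 0 \<Longrightarrow> y \<in> R" and mass: "sum U R \<le> 1 / \<nu>" for y
      using fp U unfolding fibre_pieces_def by blast+
    have mS: "sum U S = sum U R" using fin R supp by (intro sum.mono_neutral_right) auto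
    have nn: "0 \<le> sum U A" using U0 by (simp add: sum_nonneg)
    show ?thesis
    proof (cases "crosses T x U (2 * h)")
      case False
      then show ?thesis using nn \<nu> by simp
    next
      case True
      then obtain t y0 where t: "t \<in> T" "U y0 \<noteq> 0" "\<bar>N (x - y0) - t\<bar> \<le> 2 * h"
        by (auto simp: crosses_def)
      have "y \<in> A" if "U y \<noteq> 0" for y
        using fibre_pieces_diameter[OF fp c U that t(2)] N_abs_diff[of x y y0] t supp[OF that]
        by (force simp: A_def)
      then have "sum U S = sum U A" using A fin by (intro sum.mono_neutral_right) auto
      then have "(2 * h * sum U S)\<^sup>2 = 4 * h\<^sup>2 * (sum U S * sum U A)"
        by (simp add: power2_eq_square)
      also have "\<dots> \<le> 4 * h\<^sup>2 * (1 / \<nu> * sum U A)"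
        using mass mS nn by (intro mult_left_mono mult_right_mono) auto
      finally show ?thesis using True by simp
    qed
  qed
  have "crossing_var T S x (map (\<lambda>U. (U, 2 * h)) ps) \<le> (\<Sum>U\<leftarrow>ps. 4 * h\<^sup>2 / \<nu> * sum U A)"
    unfolding crossing_var_def using each by (auto simp: o_def intro!: sum_list_mono)
  also have "\<dots> = 4 * h\<^sup>2 / \<nu> * (\<Sum>y\<in>A. \<Sum>U\<leftarrow>ps. U y)"
    by (induction ps) (simp_all add: sum.distrib distrib_left)
  also have "\<dots> \<le> 4 * h\<^sup>2 / \<nu> * sum u A"
    using fp u \<nu> by (intro mult_left_mono sum_mono) (auto simp: fibre_pieces_def)
  finally show ?thesis by (simp add: A_def)
qed

lemma crossing_var_append: "crossing_var T S x (ps @ qs) = crossing_var T S x ps + crossing_var T S x qs"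
  by (simp add: crossing_var_def)

definition piece_ok :: "'a set \<Rightarrow> ('a \<Rightarrow> real) \<Rightarrow> real \<Rightarrow> bool" where
  "piece_ok S U d \<longleftrightarrow> 0 < d \<and> (\<forall>y. 0 \<le> U y \<and> (U y \<noteq> 0 \<longrightarrow> y \<in> S)) \<and>
     (\<forall>y y'. U y \<noteq> 0 \<longrightarrow> U y' \<noteq> 0 \<longrightarrow> N (y - y') \<le> d)"

text \<open>Origin of the factors in \<open>scale_bound\<close>: 24 = 4 * 6, with 4 from the square
  of 2H and 6 from 4H + 2h \<le> 6H; 4 powr \<beta> comes from 2 / h \<le> 4 / H.\<close>

definition var_const :: "real set \<Rightarrow> real" where
  "var_const T = 24 * real (card T) * shell_const * c4 * 4 powr \<beta>"

text \<open>The two options for h are the two uses: pieces of scale H cut from a remainder that is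
  light for the net of scale H / 2, and the final pieces, light for the net of scale H
  itself.\<close>

lemma scale_bound:
  assumes H: "0 < H" and h: "h = H / 2 \<or> h = H" and \<nu>: "\<nu> > 0"
  shows "4 * H\<^sup>2 / \<nu> * (c4 * (2 / h) powr \<beta> * (real (card T) * (shell_const * (4 * H + 2 * h))) / \<nu>)
    \<le> var_const T * H powr (3 - \<beta>) / \<nu>\<^sup>2"
proof -
  have "(2 / h) powr \<beta> \<le> (4 / H) powr \<beta>"
    using H h params by (intro powr_mono2) (auto simp: field_simps)
  also have "\<dots> = 4 powr \<beta> * H powr (- \<beta>)"
    using H by (simp add: powr_divide powr_minus_divide)
  finally have p: "(2 / h) powr \<beta> \<le> 4 powr \<beta> * H powr (- \<beta>)" .
  have "c4 * (2 / h) powr \<beta> * (real (card T) * (shell_const * (4 * H + 2 * h)))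
      \<le> c4 * (4 powr \<beta> * H powr (- \<beta>)) * (real (card T) * (shell_const * (6 * H)))"
    using p params shell_const_pos H h by (intro mult_mono mult_left_mono) auto
  then have "4 * H\<^sup>2 / \<nu> * (c4 * (2 / h) powr \<beta> * (real (card T) * (shell_const * (4 * H + 2 * h))) / \<nu>)
      \<le> 4 * H\<^sup>2 / \<nu> * (c4 * (4 powr \<beta> * H powr (- \<beta>)) * (real (card T) * (shell_const * (6 * H))) / \<nu>)"
    using \<nu> by (intro mult_left_mono divide_right_mono) auto
  also have "\<dots> = var_const T * (H ^ 3 * H powr (- \<beta>)) / \<nu>\<^sup>2"
    by (simp add: var_const_def power2_eq_square power3_eq_cube)
  also have "H ^ 3 * H powr (- \<beta>) = H powr (3 - \<beta>)"
    using H by (simp add: powr_diff powr_minus_divide powr_numeral)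
  finally show ?thesis .
qed

text \<open>The decisive part of the invariant is that the remainder R is light for the current net
  (Y, c): this is what \<open>shell_mass\<close> needs for the pieces of the next scale. The nets of
  different scales are chosen independently of each other.\<close>

lemma multiscale_pieces_aux:
  assumes S: "finite S" "S \<subseteq> \<Omega>" and u: "\<And>y. 0 \<le> u y" "sum u S \<le> 1"
    and \<nu>: "\<nu> > 0" and e: "e > 0" and T: "finite T" "T \<subseteq> {0..2}"
    and H: "e * 2 ^ k \<le> 4"
  shows "\<exists>qs R c Y. R \<subseteq> S \<and> (\<forall>(U, d)\<in>set qs. piece_ok S U d) \<and>
    (\<forall>y. (\<Sum>(U, d)\<leftarrow>qs. U y) = (if y \<in> S - R then u y else 0)) \<and>
    real (length qs) \<le> 2 * \<nu> * sum u (S - R) \<and>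
    finite Y \<and> Y \<subseteq> \<Omega> \<and> separated N (e * 2 ^ k) Y \<and> real (card Y) \<le> c4 * (2 / (e * 2 ^ k)) powr \<beta> \<and>
    (\<forall>y\<in>S. c y \<in> Y \<and> N (y - c y) \<le> e * 2 ^ k) \<and>
    (\<forall>z. sum u {y\<in>R. c y = z} \<le> 1 / \<nu>) \<and>
    (\<forall>x\<in>\<Omega>. crossing_var T S x qs \<le> 4 * e\<^sup>2 / \<nu> + var_const T * (\<Sum>j=1..k. (e * 2 ^ j) powr (3 - \<beta>)) / \<nu>\<^sup>2)"
  using H
proof (induction k)
  case 0
  obtain Y where Y: "finite Y" "Y \<subseteq> \<Omega>" "separated N e Y" "real (card Y) \<le> c4 * (2 / e) powr \<beta>"
    "\<And>y. y \<in> \<Omega> \<Longrightarrow> \<exists>x\<in>Y. N (y - x) < e" using net_exists[of e] e 0 by auto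
  then obtain c where c: "\<And>y. y \<in> \<Omega> \<Longrightarrow> c y \<in> Y \<and> N (y - c y) < e" by metis
  have c': "N (y - c y) \<le> e" "c y \<in> Y" if "y \<in> S" for y using c[of y] that S by auto
  obtain ps R where ps: "fibre_pieces c \<nu> u S R ps" "real (length ps) \<le> 2 * \<nu> * sum u (S - R)"
    "\<forall>z. sum u {y\<in>R. c y = z} \<le> 1 / \<nu>"
    using split_heavy_fibres[of S u \<nu> c, OF S(1) u(1) \<nu>] by blast
  define qs where "qs = map (\<lambda>U. (U, 2 * e)) ps"
  have "crossing_var T S x qs \<le> 4 * e\<^sup>2 / \<nu>" for x
  proof -
    have "crossing_var T S x qs \<le> 4 * e\<^sup>2 / \<nu> * sum u {y\<in>S. \<exists>t\<in>T. \<bar>N (x - y) - t\<bar> \<le> 4 * e}"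
      unfolding qs_def using c' by (intro crossing_var_fibre_pieces[where u = u, OF ps(1) _ S(1) _ u(1) \<nu> e]) auto
    \<comment> \<open>At the finest scale no lightness is known, so the mass near the kink spheres
      is bounded by the whole mass.\<close>
    also have "\<dots> \<le> 4 * e\<^sup>2 / \<nu> * sum u S"
      using S u \<nu> by (intro mult_left_mono sum_mono2) auto
    also have "\<dots> \<le> 4 * e\<^sup>2 / \<nu> * 1" using u \<nu> by (intro mult_left_mono) auto
    finally show ?thesis by simp
  qed
  moreover have "\<forall>(U, d)\<in>set qs. piece_ok S U d"
    using ps(1) fibre_pieces_diameter[OF ps(1) c'(1)] e by (auto simp: qs_def piece_ok_def fibre_pieces_def)
  moreover have "(\<Sum>(U, d)\<leftarrow>qs. U y) = (if y \<in> S - R then u y else 0)" for y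
    using ps(1) by (simp add: qs_def fibre_pieces_def o_def)
  ultimately show ?case using ps Y c'
    by (intro exI[of _ qs] exI[of _ R] exI[of _ c] exI[of _ Y]) (auto simp: qs_def fibre_pieces_def)
next
  case (Suc k)
  define h where "h = e * 2 ^ k"
  define H where "H = e * 2 ^ Suc k"
  have hH: "h = H / 2" "0 < h" "0 < H" "h \<le> 4" "H \<le> 4" using e Suc.prems by (auto simp: h_def H_def)
  obtain qs R c Y where IH: "R \<subseteq> S" "\<forall>(U, d)\<in>set qs. piece_ok S U d"
    "\<forall>y. (\<Sum>(U, d)\<leftarrow>qs. U y) = (if y \<in> S - R then u y else 0)"
    "real (length qs) \<le> 2 * \<nu> * sum u (S - R)"
    "finite Y" "Y \<subseteq> \<Omega>" "separated N h Y"
    "\<forall>y\<in>S. c y \<in> Y \<and> N (y - c y) \<le> h" "\<forall>z. sum u {y\<in>R. c y = z} \<le> 1 / \<nu>"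
    "\<forall>x\<in>\<Omega>. crossing_var T S x qs \<le> 4 * e\<^sup>2 / \<nu> + var_const T * (\<Sum>j=1..k. (e * 2 ^ j) powr (3 - \<beta>)) / \<nu>\<^sup>2"
    using Suc.IH hH(4) unfolding h_def by blast
  have R: "finite R" using IH(1) S(1) finite_subset by blast
  obtain Y' where Y': "finite Y'" "Y' \<subseteq> \<Omega>" "separated N H Y'" "real (card Y') \<le> c4 * (2 / H) powr \<beta>"
    "\<And>y. y \<in> \<Omega> \<Longrightarrow> \<exists>x\<in>Y'. N (y - x) < H" using net_exists[of H] hH by auto
  then obtain c' where "\<And>y. y \<in> \<Omega> \<Longrightarrow> c' y \<in> Y' \<and> N (y - c' y) < H" by metis
  then have c': "N (y - c' y) \<le> H" "c' y \<in> Y'" if "y \<in> S" for y using that S by (auto intro: less_imp_le)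
  obtain ps R' where ps: "fibre_pieces c' \<nu> u R R' ps" "real (length ps) \<le> 2 * \<nu> * sum u (R - R')"
    "\<forall>z. sum u {y\<in>R'. c' y = z} \<le> 1 / \<nu>"
    using split_heavy_fibres[of R u \<nu> c', OF R u(1) \<nu>] by blast
  have R': "R' \<subseteq> R" using ps(1) by (simp add: fibre_pieces_def)
  define qs' where "qs' = map (\<lambda>U. (U, 2 * H)) ps"
  have var: "crossing_var T S x qs' \<le> var_const T * H powr (3 - \<beta>) / \<nu>\<^sup>2" if x: "x \<in> \<Omega>" for x
  proof -
    have "crossing_var T S x qs' \<le> 4 * H\<^sup>2 / \<nu> * sum u {y\<in>R. \<exists>t\<in>T. \<bar>N (x - y) - t\<bar> \<le> 4 * H}"
      unfolding qs'_def using c' IH(1) hH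
      by (intro crossing_var_fibre_pieces[where u = u, OF ps(1) _ S(1) _ u(1) \<nu>]) auto
    \<comment> \<open>The pieces live on cells of the new net of scale H, but lightness is used for
      the old net of scale h = H / 2.\<close>
    also have "\<dots> \<le> 4 * H\<^sup>2 / \<nu> *
        (c4 * (2 / h) powr \<beta> * (real (card T) * (shell_const * (4 * H + 2 * h))) / \<nu>)"
      using IH hH \<nu> by (intro mult_left_mono shell_mass[where u = u, OF x IH(5-7) _ _ T _ R _ _ u(1) _ \<nu>, where c = c]) auto
    also have "\<dots> \<le> var_const T * H powr (3 - \<beta>) / \<nu>\<^sup>2"
      using hH \<nu> by (intro scale_bound) auto
    finally show ?thesis .
  qed
  have "piece_ok S U d" if "(U, d) \<in> set qs'" for U d
  proof -
    have U: "U \<in> set ps" "d = 2 * H" using that by (auto simp: qs'_def)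
    have "N (y - c' y) \<le> H" if "y \<in> R" for y using c'(1) IH(1) that by auto
    from fibre_pieces_diameter[OF ps(1) this U(1)] show ?thesis
      using U ps(1) IH(1) hH unfolding piece_ok_def fibre_pieces_def by auto
  qed
  then have 1: "\<forall>(U, d)\<in>set (qs @ qs'). piece_ok S U d" using IH(2) by auto
  have 2: "(\<Sum>(U, d)\<leftarrow>qs @ qs'. U y) = (if y \<in> S - R' then u y else 0)" for y
  proof -
    have "(\<Sum>(U, d)\<leftarrow>qs'. U y) = (if y \<in> R - R' then u y else 0)"
      using ps(1) by (simp add: qs'_def fibre_pieces_def o_def)
    then show ?thesis using IH(1,3) R' by auto
  qed
  have "S - R' = (S - R) \<union> (R - R')" using IH(1) R' by auto
  then have "sum u (S - R') = sum u (S - R) + sum u (R - R')"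
    using S(1) R by (auto intro!: sum.union_disjoint)
  then have 3: "real (length (qs @ qs')) \<le> 2 * \<nu> * sum u (S - R')"
    using IH(4) ps(2) by (simp add: qs'_def algebra_simps)
  have 4: "crossing_var T S x (qs @ qs') \<le> 4 * e\<^sup>2 / \<nu> +
      var_const T * (\<Sum>j=1..Suc k. (e * 2 ^ j) powr (3 - \<beta>)) / \<nu>\<^sup>2" if "x \<in> \<Omega>" for x
    using IH(10) var[OF that] that
    by (simp add: crossing_var_append H_def algebra_simps add_divide_distrib) force
  show ?case unfolding H_def[symmetric]
    using 1 2 3 4 ps(3) Y' c' R' IH(1)
    by (intro exI[of _ "qs @ qs'"] exI[of _ R'] exI[of _ c'] exI[of _ Y'])
       (auto simp: H_def[symmetric] simp del: map_append sum_list_append)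
qed

text \<open>The coarsest scale is the one at which a net has at most c4 * 2 powr \<beta> * \<nu>
  points, so that one piece per remaining cell is affordable. The variance of these last pieces is
  bounded by a second copy of the term j = I, whence the factor 2; 1 \<le> I puts that term into the
  sum.\<close>

lemma multiscale_pieces:
  assumes S: "finite S" "S \<subseteq> \<Omega>" and u: "\<And>y. 0 \<le> u y" "sum u S \<le> 1"
    and \<nu>: "\<nu> > 0" and e: "e > 0" and T: "finite T" "T \<subseteq> {0..2}"
    and I: "1 \<le> I" "e * 2 ^ I = \<nu> powr (- 1 / \<beta>)" "e * 2 ^ I \<le> 4"
  shows "\<exists>qs. (\<forall>(U, d)\<in>set qs. piece_ok S U d) \<and>
    (\<forall>y. (\<Sum>(U, d)\<leftarrow>qs. U y) = (if y \<in> S then u y else 0)) \<and>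
    real (length qs) \<le> (2 + c4 * 2 powr \<beta>) * \<nu> \<and>
    (\<forall>x\<in>\<Omega>. crossing_var T S x qs \<le> 4 * e\<^sup>2 / \<nu> + 2 * var_const T * (\<Sum>j=1..I. (e * 2 ^ j) powr (3 - \<beta>)) / \<nu>\<^sup>2)"
proof -
  define H where "H = e * 2 ^ I"
  have H: "0 < H" "H \<le> 4" using e I by (auto simp: H_def)
  obtain qs R c Y where *: "R \<subseteq> S" "\<forall>(U, d)\<in>set qs. piece_ok S U d"
    "\<forall>y. (\<Sum>(U, d)\<leftarrow>qs. U y) = (if y \<in> S - R then u y else 0)"
    "real (length qs) \<le> 2 * \<nu> * sum u (S - R)"
    "finite Y" "Y \<subseteq> \<Omega>" "separated N H Y" 
    "\<forall>y\<in>S. c y \<in> Y \<and> N (y - c y) \<le> H" "\<forall>z. sum u {y\<in>R. c y = z} \<le> 1 / \<nu>"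
    "\<forall>x\<in>\<Omega>. crossing_var T S x qs \<le> 4 * e\<^sup>2 / \<nu> + var_const T * (\<Sum>j=1..I. (e * 2 ^ j) powr (3 - \<beta>)) / \<nu>\<^sup>2"
    "real (card Y) \<le> c4 * (2 / H) powr \<beta>"
    using multiscale_pieces_aux[OF S u \<nu> e T I(3)] unfolding H_def by blast
  have R: "finite R" using *(1) S(1) finite_subset by blast
  obtain ps where ps: "fibre_pieces c \<nu> u R {} ps" "length ps \<le> card (c ` R)"
    using light_fibres_pieces[of R u c \<nu>, OF R u(1)] *(9) by blast
  define qs' where "qs' = map (\<lambda>U. (U, 2 * H)) ps"
  have var: "crossing_var T S x qs' \<le> var_const T * H powr (3 - \<beta>) / \<nu>\<^sup>2" if x: "x \<in> \<Omega>" for x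
  proof -
    have "crossing_var T S x qs' \<le> 4 * H\<^sup>2 / \<nu> * sum u {y\<in>R. \<exists>t\<in>T. \<bar>N (x - y) - t\<bar> \<le> 4 * H}"
      unfolding qs'_def using * H
      by (intro crossing_var_fibre_pieces[where u = u, OF ps(1) _ S(1) _ u(1) \<nu>]) auto
    also have "\<dots> \<le> 4 * H\<^sup>2 / \<nu> *
        (c4 * (2 / H) powr \<beta> * (real (card T) * (shell_const * (4 * H + 2 * H))) / \<nu>)"
      using * H \<nu> by (intro mult_left_mono shell_mass[where u = u, OF x *(5-7) _ _ T _ R _ _ u(1) _ \<nu>, where c = c]) auto
    also have "\<dots> \<le> var_const T * H powr (3 - \<beta>) / \<nu>\<^sup>2"
      using H \<nu> by (intro scale_bound) auto
    finally show ?thesis .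
  qed
  have "piece_ok S U d" if "(U, d) \<in> set qs'" for U d
  proof -
    have U: "U \<in> set ps" "d = 2 * H" using that by (auto simp: qs'_def)
    have "N (y - c y) \<le> H" if "y \<in> R" for y using *(1,8) that by auto
    from fibre_pieces_diameter[OF ps(1) this U(1)] show ?thesis
      using U ps(1) *(1) H unfolding piece_ok_def fibre_pieces_def by auto
  qed
  then have 1: "\<forall>(U, d)\<in>set (qs @ qs'). piece_ok S U d" using *(2) by auto
  have 2: "(\<Sum>(U, d)\<leftarrow>qs @ qs'. U y) = (if y \<in> S then u y else 0)" for y
  proof -
    have "(\<Sum>(U, d)\<leftarrow>qs'. U y) = (if y \<in> R then u y else 0)"
      using ps(1) by (simp add: qs'_def fibre_pieces_def o_def)
    then show ?thesis using *(1,3) by auto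
  qed
  have 3: "real (length (qs @ qs')) \<le> (2 + c4 * 2 powr \<beta>) * \<nu>"
  proof -
    have "sum u (S - R) \<le> sum u S" using S u by (intro sum_mono2) auto
    then have "2 * \<nu> * sum u (S - R) \<le> 2 * \<nu> * 1" using u \<nu> by (intro mult_left_mono) auto
    moreover have "card (c ` R) \<le> card Y" using * by (intro card_mono) auto
    moreover have "(2 / H) powr \<beta> = 2 powr \<beta> * \<nu>"
    proof -
      have "(2 / H) powr \<beta> = 2 powr \<beta> / (\<nu> powr (- 1 / \<beta>)) powr \<beta>"
        using H \<nu> I by (simp add: H_def powr_divide)
      also have "(\<nu> powr (- 1 / \<beta>)) powr \<beta> = 1 / \<nu>"
        unfolding powr_powr using \<nu> params by (simp add: powr_minus_divide)
      finally show ?thesis by simp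
    qed
    ultimately show ?thesis using *(4,11) ps(2) by (simp add: qs'_def algebra_simps)
  qed
  have 4: "crossing_var T S x (qs @ qs') \<le> 4 * e\<^sup>2 / \<nu> +
      2 * var_const T * (\<Sum>j=1..I. (e * 2 ^ j) powr (3 - \<beta>)) / \<nu>\<^sup>2" if "x \<in> \<Omega>" for x
  proof -
    have "H powr (3 - \<beta>) \<le> (\<Sum>j=1..I. (e * 2 ^ j) powr (3 - \<beta>))"
      unfolding H_def using I by (intro member_le_sum[where f = "\<lambda>j. (e * 2 ^ j) powr (3 - \<beta>)"]) auto
    moreover have "0 \<le> var_const T" using params shell_const_pos by (simp add: var_const_def)
    ultimately have "var_const T * H powr (3 - \<beta>) / \<nu>\<^sup>2 \<le>
        var_const T * (\<Sum>j=1..I. (e * 2 ^ j) powr (3 - \<beta>)) / \<nu>\<^sup>2"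
      by (intro divide_right_mono mult_left_mono) auto
    then show ?thesis using *(10) var[OF that] that by (force simp: crossing_var_append)
  qed
  show ?thesis using 1 2 3 4 by blast
qed

end

section \<open>Compression of finite sums\<close>

definition kernel_ok ::
  "('a::real_vector \<Rightarrow> real) \<Rightarrow> (real \<Rightarrow> real) \<Rightarrow> (nat \<Rightarrow> real) \<Rightarrow> nat \<Rightarrow> ('a \<Rightarrow> real) set \<Rightarrow> bool" where
  "kernel_ok N \<Phi> t l Xr \<longleftrightarrow>
      (\<forall>s\<in>{0..2}. \<forall>s'\<in>{0..2}. \<bar>\<Phi> s - \<Phi> s'\<bar> \<le> \<bar>s - s'\<bar>) \<and>
      t 0 = 0 \<and> t l = 2 \<and> (\<forall>j<l. t j < t (Suc j)) \<and> translation_invariant Xr \<and>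
      (\<forall>j\<in>{1..l}. \<exists>f\<in>Xr. \<forall>x. t (j - 1) \<le> N x \<and> N x \<le> t j \<longrightarrow> \<Phi> (N x) = f x)"

lemma kernel_ok_knots:
  assumes "kernel_ok N \<Phi> t l Xr" "j \<le> l"
  shows "t j \<in> {0..2}"
proof -
  have step: "t i < t (Suc i)" if "i < l" for i using assms that by (simp add: kernel_ok_def)
  have mono: "i \<le> l \<longrightarrow> t j \<le> t i" if "j \<le> i" for i j
    using that
  proof (induction i rule: dec_induct)
    case (step n)
    then show ?case using \<open>\<And>i. i < l \<Longrightarrow> t i < t (Suc i)\<close>[of n] by auto
  qed simp
  show ?thesis using mono[of 0 j] mono[of j l] assms by (auto simp: kernel_ok_def)
qed

text \<open>As a function of - y, f (x - y) is the translate of f by - x and stays in Xr. The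
  moments against the reflected basis functions therefore handle every x, and the number of
  conditions does not grow with the number of points x.\<close>

lemma translation_invariant_span_annihilated:
  fixes v :: "'a::real_vector \<Rightarrow> real"
  assumes inv: "translation_invariant Xr" and Xr: "fun_vs.span B = Xr" and f: "f \<in> Xr"
    and ann: "\<And>b. b \<in> B \<Longrightarrow> (\<Sum>y\<in>S. v y * b (- y)) = 0"
  shows "(\<Sum>y\<in>S. v y * f (x - y)) = 0"
proof -
  define g where "g z = f (z - (- x))" for z
  have "g \<in> fun_vs.span B" using inv f Xr unfolding translation_invariant_def g_def by blast
  then have "(\<Sum>y\<in>S. v y * g (- y)) = 0"
  proof (induction rule: fun_vs.span_induct_alt)
    case base
    then show ?case by simp
  next
    case (step c b g)
    have "(\<Sum>y\<in>S. v y * ((\<lambda>x. c * b x) + g) (- y)) = c * (\<Sum>y\<in>S. v y * b (- y)) + (\<Sum>y\<in>S. v y * g (- y))"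
      by (simp add: algebra_simps sum.distrib sum_distrib_left)
    then show ?case using step ann by simp
  qed
  then show ?thesis by (simp add: g_def)
qed

context annular_regular
begin

lemma lipschitz_kernel:
  assumes "kernel_ok N \<Phi> t l Xr" "x \<in> \<Omega>" "y \<in> \<Omega>" "x' \<in> \<Omega>" "y' \<in> \<Omega>"
  shows "\<bar>\<Phi> (N (x - y)) - \<Phi> (N (x' - y'))\<bar> \<le> \<bar>N (x - y) - N (x' - y')\<bar>"
  using assms diameter[of x y] diameter[of x' y'] N_nonneg by (simp add: kernel_ok_def)

text \<open>All knots count as kinks, including t 0 = 0 and t l = 2. So N (x - y0) is more than d
  away from every knot, while N (x - y) varies by at most d over the piece and cannot leave the
  interval between the two knots around N (x - y0).\<close>

lemma uncrossed_piece_in_space: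
  assumes k: "kernel_ok N \<Phi> t l Xr" and x: "x \<in> \<Omega>" and S: "S \<subseteq> \<Omega>"
    and U: "piece_ok S U d" and nc: "\<not> crosses (t ` {..l}) x U d" and y0: "U y0 \<noteq> 0"
  shows "\<exists>f\<in>Xr. \<forall>y. U y \<noteq> 0 \<longrightarrow> \<Phi> (N (x - y)) = f (x - y)"
proof -
  have far: "d < \<bar>N (x - y) - t i\<bar>" if "U y \<noteq> 0" "i \<le> l" for y i
    using nc that by (auto simp: crosses_def not_le)
  have d: "0 < d" using U by (simp add: piece_ok_def)
  have "y0 \<in> \<Omega>" using U y0 S by (auto simp: piece_ok_def)
  then have "N (x - y0) \<le> t l" using k diameter x by (simp add: kernel_ok_def)
  define j where "j = (LEAST j. N (x - y0) \<le> t j)"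
  have j: "N (x - y0) \<le> t j" unfolding j_def by (rule LeastI) fact
  have jl: "j \<le> l" unfolding j_def by (rule Least_le) fact
  have "j \<noteq> 0"
  proof
    assume "j = 0"
    then have "N (x - y0) = t 0" using j N_nonneg[of "x - y0"] k by (simp add: kernel_ok_def)
    then show False using far[OF y0, of 0] d by simp
  qed
  then have "\<not> N (x - y0) \<le> t (j - 1)" unfolding j_def by (intro not_less_Least) simp
  then have lo: "t (j - 1) < N (x - y0)" by simp
  obtain f where f: "f \<in> Xr" "\<forall>z. t (j - 1) \<le> N z \<and> N z \<le> t j \<longrightarrow> \<Phi> (N z) = f z"
    using k jl \<open>j \<noteq> 0\<close> unfolding kernel_ok_def by (metis atLeastAtMost_iff One_nat_def Suc_leI neq0_conv)
  have "t (j - 1) \<le> N (x - y) \<and> N (x - y) \<le> t j" if "U y \<noteq> 0" for y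
  proof -
    have "N (y - y0) \<le> d" using U that y0 by (simp add: piece_ok_def)
    then show ?thesis
      using N_abs_diff[of x y y0] far[OF y0 jl] far[OF y0, of "j - 1"] lo j jl by linarith
  qed
  then show ?thesis using f by (intro bexI[of _ f]) auto
qed

text \<open>The pieces decompose the absolute weights, so that masses are nonnegative; the signs s
  return through the functionals in F, and a piece may contain both signs. X is the set of points at
  which the errors are balanced.\<close>

lemma finite_quadrature:
  fixes w :: "'a \<Rightarrow> real"
  assumes k: "kernel_ok N \<Phi> t l Xr" and B: "finite B" "fun_vs.span B = Xr"
    and S: "finite S" "S \<subseteq> \<Omega>" and w: "(\<Sum>y\<in>S. \<bar>w y\<bar>) \<le> 1"
    and \<nu>: "\<nu> > 0" and e: "e > 0" and I: "1 \<le> I" "e * 2 ^ I = \<nu> powr (- 1 / \<beta>)" "e * 2 ^ I \<le> 4"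
    and X: "finite X" "X \<noteq> {}" "X \<subseteq> \<Omega>" and V: "V > 0"
    and var: "4 * (4 * e\<^sup>2 / \<nu> + 2 * var_const (t ` {..l}) * (\<Sum>j=1..I. (e * 2 ^ j) powr (3 - \<beta>)) / \<nu>\<^sup>2) \<le> V"
  shows "\<exists>lam Y. Y \<subseteq> S \<and> real (card Y) \<le> (real (card B) + 2) * ((2 + c4 * 2 powr \<beta>) * \<nu>) \<and>
    (\<forall>y. lam y \<noteq> 0 \<longrightarrow> y \<in> Y) \<and> (\<Sum>y\<in>S. \<bar>lam y\<bar>) \<le> 1 \<and>
    (\<forall>x\<in>X. \<bar>(\<Sum>y\<in>S. w y * \<Phi> (N (x - y))) - (\<Sum>y\<in>S. lam y * \<Phi> (N (x - y)))\<bar> \<le> sqrt (2 * V * ln (2 * real (card X))))"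
proof -
  define s where "s y = sgn (w y)" for y
  define u where "u y = (if y \<in> S then \<bar>w y\<bar> else 0)" for y
  define T where "T = t ` {..l}"
  have T: "finite T" "T \<subseteq> {0..2}" using kernel_ok_knots[OF k] by (auto simp: T_def)
  have u: "0 \<le> u y" "sum u S \<le> 1" for y using w by (auto simp: u_def)
  obtain qs where qs: "\<forall>(U, d)\<in>set qs. piece_ok S U d"
    "\<forall>y. (\<Sum>(U, d)\<leftarrow>qs. U y) = (if y \<in> S then u y else 0)"
    "real (length qs) \<le> (2 + c4 * 2 powr \<beta>) * \<nu>"
    "\<forall>x\<in>\<Omega>. crossing_var T S x qs \<le> 4 * e\<^sup>2 / \<nu> + 2 * var_const T * (\<Sum>j=1..I. (e * 2 ^ j) powr (3 - \<beta>)) / \<nu>\<^sup>2"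
    using multiscale_pieces[of S u \<nu> e T I, OF S u \<nu> e T I] by blast
  define m where "m = length qs"
  define U where "U i = fst (qs ! i)" for i
  define d where "d i = snd (qs ! i)" for i
  have ok: "piece_ok S (U i) (d i)" if "i < m" for i
    using qs(1) nth_mem[of i qs] that by (auto simp: m_def U_def d_def case_prod_beta)
  then have U: "0 \<le> U i y" "U i y \<noteq> 0 \<Longrightarrow> y \<in> S" if "i < m" for i y
    using that by (auto simp: piece_ok_def)
  have Usum: "(\<Sum>i<m. U i y) = u y" for y
  proof -
    have "(\<Sum>(U, d)\<leftarrow>qs. U y) = (\<Sum>i<m. U i y)"
      by (simp add: m_def U_def sum_list_sum_nth case_prod_beta atLeast0LessThan cong: if_cong)
    moreover have "(if y \<in> S then u y else 0) = u y" by (simp add: u_def)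
    ultimately show ?thesis using qs(2) by simp
  qed
  \<comment> \<open>Moments against the translates of Xr; the total mass, for
    \<open>sparse_reduction\<close> and the bound on \<open>lam\<close>; the signed mass s, which
    permits subtracting a constant from the kernel on a crossing piece. Hence the two points beyond
    \<open>card B\<close>.\<close>
  define F where "F = (\<lambda>b y. s y * b (- y)) ` B \<union> {\<lambda>_. 1, s}"
  have F: "finite F" "card F \<le> card B + 2"
  proof -
    show "finite F" using B by (simp add: F_def)
    have "card F \<le> card ((\<lambda>b y. s y * b (- y)) ` B) + card {\<lambda>_. 1, s}"
      unfolding F_def by (rule card_Un_le)
    also have "\<dots> \<le> card B + 2" using B by (intro add_mono card_image_le) (auto simp: card_insert_if)
    finally show "card F \<le> card B + 2" .
  qed
  \<comment> \<open>The admissible sparse replacements of piece i; \<open>Z i v x\<close> is the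
    change at x that the replacement v causes.\<close>
  define Opt where "Opt i = {v. (\<forall>y. 0 \<le> v y) \<and> (\<forall>y. U i y = 0 \<longrightarrow> v y = 0) \<and>
      card {y. v y \<noteq> 0} \<le> card F \<and> (\<forall>\<phi>\<in>F. (\<Sum>y\<in>S. v y * \<phi> y) = (\<Sum>y\<in>S. U i y * \<phi> y))}" for i
  define Z where "Z i v x = (\<Sum>y\<in>S. (v y - U i y) * s y * \<Phi> (N (x - y)))" for i v x
  define b where "b i x = (if crosses T x (U i) (d i) then 2 * (d i * sum (U i) S) else 0)" for i x
  have lin: "\<exists>v\<in>Opt i. (\<Sum>x\<in>X. c x * Z i v x) \<le> 0" if i: "i < m" for i and c :: "'a \<Rightarrow> real"
  proof -
    \<comment> \<open>The change is affine in v, so every linear combination over x is an objective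
      for \<open>sparse_reduction\<close>, where leaving the piece \<open>U i\<close> as it is has
      value 0.\<close>
    define a where "a y = (\<Sum>x\<in>X. c x * (s y * \<Phi> (N (x - y))))" for y
    obtain v where v: "v \<in> Opt i" "(\<Sum>y\<in>S. v y * a y) \<le> (\<Sum>y\<in>S. U i y * a y)"
      using sparse_reduction[of F S "U i" a] F(1) S(1) U[OF i] unfolding Opt_def F_def by blast
    have "(\<Sum>x\<in>X. c x * Z i v x) = (\<Sum>x\<in>X. \<Sum>y\<in>S. (v y - U i y) * (c x * (s y * \<Phi> (N (x - y)))))"
      by (simp add: Z_def sum_distrib_left mult.assoc mult.left_commute)
    also have "\<dots> = (\<Sum>y\<in>S. (v y - U i y) * a y)"
      unfolding a_def sum_distrib_left by (rule sum.swap)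
    also have "\<dots> \<le> 0" using v(2) by (simp add: left_diff_distrib sum_subtractf)
    finally show ?thesis using v(1) by blast
  qed
  have bnd: "\<bar>Z i v x\<bar> \<le> b i x" if i: "i < m" and v: "v \<in> Opt i" and x: "x \<in> X" for i v x
  proof -
    have x\<Omega>: "x \<in> \<Omega>" using x X by auto
    have vU: "v y = 0" if "U i y = 0" for y using v that by (simp add: Opt_def)
    have v0: "0 \<le> v y" for y using v by (simp add: Opt_def)
    have exact: "(\<Sum>y\<in>S. (v y - U i y) * \<phi> y) = 0" if "\<phi> \<in> F" for \<phi>
      using v that by (simp add: Opt_def left_diff_distrib sum_subtractf)
    have mass: "sum v S = sum (U i) S" using exact[of "\<lambda>_. 1"] by (simp add: F_def sum_subtractf)
    show ?thesis
    proof (cases "\<exists>y0. U i y0 \<noteq> 0")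
      case False
      then have "Z i v x = 0" "sum (U i) S = 0" using vU by (simp_all add: Z_def)
      then show ?thesis by (simp add: b_def)
    next
      case True
      then obtain y0 where y0: "U i y0 \<noteq> 0" by blast
      show ?thesis
      proof (cases "crosses T x (U i) (d i)")
        case False
        then obtain f where f: "f \<in> Xr" "\<And>y. U i y \<noteq> 0 \<Longrightarrow> \<Phi> (N (x - y)) = f (x - y)"
          using uncrossed_piece_in_space[OF k x\<Omega> S(2) ok[OF i] _ y0] unfolding T_def by blast
        have "Z i v x = (\<Sum>y\<in>S. ((v y - U i y) * s y) * f (x - y))"
          unfolding Z_def using f(2) vU by (intro sum.cong refl) (metis diff_self mult_zero_left)
        also have "\<dots> = 0"
        proof (rule translation_invariant_span_annihilated[OF _ B(2) f(1)])
          show "translation_invariant Xr" using k by (simp add: kernel_ok_def)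
          show "(\<Sum>y\<in>S. (v y - U i y) * s y * b (- y)) = 0" if "b \<in> B" for b
            using exact[of "\<lambda>y. s y * b (- y)"] that by (simp add: F_def mult.assoc)
        qed
        finally show ?thesis using False by (simp add: b_def)
      next
        case True
        have d: "0 < d i" using ok[OF i] by (simp add: piece_ok_def)
        \<comment> \<open>Since s is in F, the constant \<Phi> (N (x - y0)) may be subtracted from
          the kernel; the Lipschitz condition then bounds what is left by
          \<open>d i\<close>.\<close>
        have "(\<Sum>y\<in>S. (v y - U i y) * s y * \<Phi> (N (x - y0))) = 0"
          using exact[of s] by (simp add: F_def flip: sum_distrib_right)
        then have "Z i v x = (\<Sum>y\<in>S. (v y - U i y) * s y * (\<Phi> (N (x - y)) - \<Phi> (N (x - y0))))"
          by (simp add: Z_def right_diff_distrib sum_subtractf)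
        also have "\<bar>\<dots>\<bar> \<le> (\<Sum>y\<in>S. (v y + U i y) * d i)"
        proof (rule order.trans[OF sum_abs], rule sum_mono)
          fix y assume y: "y \<in> S"
          show "\<bar>(v y - U i y) * s y * (\<Phi> (N (x - y)) - \<Phi> (N (x - y0)))\<bar> \<le> (v y + U i y) * d i"
          proof (cases "U i y = 0")
            case True
            then show ?thesis using vU by simp
          next
            case False
            have "N (y - y0) \<le> d i" using ok[OF i] False y0 by (simp add: piece_ok_def)
            then have \<Phi>d: "\<bar>\<Phi> (N (x - y)) - \<Phi> (N (x - y0))\<bar> \<le> d i"
              using lipschitz_kernel[OF k x\<Omega> _ x\<Omega>, of y y0] N_abs_diff[of x y y0] y y0 U[OF i] S by force
            have "\<bar>v y - U i y\<bar> * \<bar>s y\<bar> \<le> (v y + U i y) * 1"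
              using v0[of y] U(1)[OF i, of y] by (intro mult_mono) (auto simp: s_def sgn_if)
            then have "\<bar>v y - U i y\<bar> * \<bar>s y\<bar> * \<bar>\<Phi> (N (x - y)) - \<Phi> (N (x - y0))\<bar> \<le> (v y + U i y) * d i"
              using \<Phi>d v0[of y] U(1)[OF i, of y] by (intro mult_mono) auto
            then show ?thesis by (simp add: abs_mult)
          qed
        qed
        also have "\<dots> = 2 * (d i * sum (U i) S)"
          using mass by (simp add: sum.distrib flip: sum_distrib_right)
        finally show ?thesis using True by (simp add: b_def)
      qed
    qed
  qed
  have bvar: "(\<Sum>i<m. (b i x)\<^sup>2) \<le> V" if x: "x \<in> X" for x
  proof -
    have "(b i x)\<^sup>2 = 4 * (if crosses T x (U i) (d i) then (d i * sum (U i) S)\<^sup>2 else 0)" for i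
      by (simp add: b_def power_mult_distrib)
    then have "(\<Sum>i<m. (b i x)\<^sup>2) =
        4 * (\<Sum>i<m. if crosses T x (U i) (d i) then (d i * sum (U i) S)\<^sup>2 else 0)"
      by (simp only: sum_distrib_left)
    also have "\<dots> = 4 * crossing_var T S x qs"
      by (simp add: crossing_var_def m_def U_def d_def sum_list_sum_nth case_prod_beta atLeast0LessThan cong: if_cong)
    also have "\<dots> \<le> V" using qs(4) var x X(3) unfolding T_def by force
    finally show ?thesis .
  qed
  obtain \<omega> where \<omega>: "\<forall>i<m. \<omega> i \<in> Opt i"
    "\<forall>x\<in>X. \<bar>\<Sum>i<m. Z i (\<omega> i) x\<bar> \<le> sqrt (2 * V * ln (2 * real (card X)))"
    using uniform_sign_balanced_choice[OF X(1,2) lin bnd bvar V] by blast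
  define lam where "lam y = s y * (\<Sum>i<m. \<omega> i y)" for y
  define Y where "Y = (\<Union>i<m. {y. \<omega> i y \<noteq> 0})"
  have \<omega>0: "0 \<le> \<omega> i y" and \<omega>S: "\<omega> i y \<noteq> 0 \<Longrightarrow> y \<in> S" and \<omega>c: "card {y. \<omega> i y \<noteq> 0} \<le> card F"
    and \<omega>m: "sum (\<omega> i) S = sum (U i) S" if "i < m" for i y
  proof -
    have *: "\<omega> i \<in> Opt i" using \<omega>(1) that by blast
    then show "0 \<le> \<omega> i y" "card {y. \<omega> i y \<noteq> 0} \<le> card F" by (auto simp: Opt_def)
    show "\<omega> i y \<noteq> 0 \<Longrightarrow> y \<in> S" using * U(2)[OF that, of y] by (auto simp: Opt_def)
    have "(\<lambda>_. 1) \<in> F" by (simp add: F_def)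
    moreover have "\<forall>\<phi>\<in>F. (\<Sum>y\<in>S. \<omega> i y * \<phi> y) = (\<Sum>y\<in>S. U i y * \<phi> y)"
      using * by (simp add: Opt_def)
    ultimately have "(\<Sum>y\<in>S. \<omega> i y * 1) = (\<Sum>y\<in>S. U i y * 1)" by (rule bspec[rotated])
    then show "sum (\<omega> i) S = sum (U i) S" by simp
  qed
  have YS: "Y \<subseteq> S" using \<omega>S by (auto simp: Y_def)
  have "real (card Y) \<le> (real (card B) + 2) * ((2 + c4 * 2 powr \<beta>) * \<nu>)"
  proof -
    have "card Y \<le> (\<Sum>i<m. card {y. \<omega> i y \<noteq> 0})" unfolding Y_def by (rule card_UN_le) simp
    also have "\<dots> \<le> (\<Sum>i<m. card B + 2)"
      using \<omega>c F(2) by (intro sum_mono) (meson lessThan_iff order.trans)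
    also have "\<dots> = (card B + 2) * m" by simp
    finally have "real (card Y) \<le> (real (card B) + 2) * real m"
      by (metis of_nat_add of_nat_le_iff of_nat_mult of_nat_numeral)
    also have "\<dots> \<le> (real (card B) + 2) * ((2 + c4 * 2 powr \<beta>) * \<nu>)"
      using qs(3) unfolding m_def by (intro mult_left_mono) auto
    finally show ?thesis .
  qed
  moreover have "y \<in> Y" if "lam y \<noteq> 0" for y
  proof (rule ccontr)
    assume "y \<notin> Y"
    then have "\<And>i. i < m \<Longrightarrow> \<omega> i y = 0" by (auto simp: Y_def)
    then show False using that by (simp add: lam_def)
  qed
  moreover have "(\<Sum>y\<in>S. \<bar>lam y\<bar>) \<le> 1"
  proof -
    have "(\<Sum>y\<in>S. \<bar>lam y\<bar>) \<le> (\<Sum>y\<in>S. \<Sum>i<m. \<omega> i y)"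
    proof (rule sum_mono)
      fix y
      have "0 \<le> (\<Sum>i<m. \<omega> i y)" using \<omega>0 by (intro sum_nonneg) auto
      then show "\<bar>lam y\<bar> \<le> (\<Sum>i<m. \<omega> i y)" by (simp add: lam_def abs_mult s_def sgn_if)
    qed
    also have "\<dots> = (\<Sum>i<m. sum (\<omega> i) S)" by (rule sum.swap)
    also have "\<dots> = (\<Sum>i<m. sum (U i) S)" by (rule sum.cong) (simp_all add: \<omega>m)
    also have "\<dots> = (\<Sum>y\<in>S. \<Sum>i<m. U i y)" by (rule sum.swap)
    also have "\<dots> = sum u S" by (simp add: Usum)
    finally show ?thesis using u(2) by simp
  qed
  moreover have "\<bar>(\<Sum>y\<in>S. w y * \<Phi> (N (x - y))) - (\<Sum>y\<in>S. lam y * \<Phi> (N (x - y)))\<bar>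
      \<le> sqrt (2 * V * ln (2 * real (card X)))" if x: "x \<in> X" for x
  proof -
    have "(\<Sum>i<m. Z i (\<omega> i) x) = (\<Sum>y\<in>S. \<Sum>i<m. (\<omega> i y - U i y) * (s y * \<Phi> (N (x - y))))"
      unfolding Z_def by (subst sum.swap) (simp add: mult.assoc)
    also have "\<dots> = (\<Sum>y\<in>S. ((\<Sum>i<m. \<omega> i y) - u y) * (s y * \<Phi> (N (x - y))))"
      by (simp only: flip: sum_distrib_right) (simp add: sum_subtractf Usum)
    also have "\<dots> = (\<Sum>y\<in>S. lam y * \<Phi> (N (x - y)) - w y * \<Phi> (N (x - y)))"
    proof (rule sum.cong[OF refl])
      fix y assume "y \<in> S"
      then have "u y * s y = w y" by (simp add: u_def s_def abs_mult_sgn)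
      then have "w y * \<Phi> (N (x - y)) = u y * s y * \<Phi> (N (x - y))" by simp
      then show "((\<Sum>i<m. \<omega> i y) - u y) * (s y * \<Phi> (N (x - y))) =
          lam y * \<Phi> (N (x - y)) - w y * \<Phi> (N (x - y))"
        by (simp add: lam_def algebra_simps)
    qed
    also have "\<dots> = (\<Sum>y\<in>S. lam y * \<Phi> (N (x - y))) - (\<Sum>y\<in>S. w y * \<Phi> (N (x - y)))"
      by (simp add: sum_subtractf)
    finally have eq: "(\<Sum>i<m. Z i (\<omega> i) x) = \<dots>" .
    have "\<bar>\<Sum>i<m. Z i (\<omega> i) x\<bar> \<le> sqrt (2 * V * ln (2 * real (card X)))" using \<omega>(2) x by blast
    then show ?thesis unfolding eq by (subst abs_minus_commute)
  qed
  ultimately show ?thesis using YS by (intro exI[of _ lam] exI[of _ Y]) blast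
qed

end

section \<open>Balancing the scales\<close>

lemma sum_geometric_rev_le:
  fixes r :: real
  assumes "0 < r" "r < 1"
  shows "(\<Sum>j=1..n. r ^ (n - j)) \<le> 1 / (1 - r)"
proof (induction n)
  case 0
  then show ?case using assms by simp
next
  case (Suc n)
  have "(\<Sum>j=1..Suc n. r ^ (Suc n - j)) = (\<Sum>j=1..n. r * r ^ (n - j)) + 1"
    by (simp add: Suc_diff_le)
  also have "\<dots> = r * (\<Sum>j=1..n. r ^ (n - j)) + 1" by (simp add: sum_distrib_left)
  also have "\<dots> \<le> r * (1 / (1 - r)) + 1" using Suc assms by (intro add_right_mono mult_left_mono) auto
  also have "\<dots> = 1 / (1 - r)" using assms by (simp add: field_simps)
  finally show ?case .
qed

lemma sum_geometric_le:
  fixes r :: real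
  assumes "0 < r" "r < 1"
  shows "(\<Sum>j=1..n. r ^ (j - 1)) \<le> 1 / (1 - r)"
proof -
  have "(\<Sum>j=1..n. r ^ (j - 1)) = (\<Sum>j=1..n. r ^ (n - j))"
    by (rule sum.reindex_bij_witness[of _ "\<lambda>j. n + 1 - j" "\<lambda>j. n + 1 - j"]) auto
  then show ?thesis using sum_geometric_rev_le[OF assms] by simp
qed

text \<open>The variance bound of \<open>multiscale_pieces\<close> up to constants, with finest
  scale e and coarsest scale e * 2 ^ I.\<close>

definition scale_cost :: "real \<Rightarrow> real \<Rightarrow> real \<Rightarrow> nat \<Rightarrow> real" where
  "scale_cost \<beta> \<nu> e I = e\<^sup>2 / \<nu> + (\<Sum>j=1..I. (e * 2 ^ j) powr (3 - \<beta>)) / \<nu>\<^sup>2"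

text \<open>For \<beta> \<le> 3 the fine scales are not more expensive than the coarse ones, so e
  may be so small that e^2 / \<nu> is harmless; about log 2 \<nu> halvings of the coarsest scale are
  enough. The bound on I enters when \<beta> = 3, where every scale costs the same.\<close>

lemma scales_upto_3:
  assumes \<beta>: "1 \<le> \<beta>" and \<nu>: "1 < \<nu>"
  obtains e I where "0 < e" "1 \<le> I" "e * 2 ^ I = \<nu> powr (- 1 / \<beta>)" "real I \<le> log 2 \<nu> + 1"
    "e\<^sup>2 / \<nu> \<le> \<nu> powr (- 1 - 3 / \<beta>)"
proof -
  define I where "I = nat \<lceil>log 2 \<nu>\<rceil>"
  define e where "e = \<nu> powr (- 1 / \<beta>) / 2 ^ I"
  have l: "0 < log 2 \<nu>" using \<nu> by simp
  have I: "1 \<le> I" "log 2 \<nu> \<le> real I" "real I \<le> log 2 \<nu> + 1" unfolding I_def using l by linarith+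
  have "\<nu> = 2 powr log 2 \<nu>" using \<nu> by simp
  also have "\<dots> \<le> 2 powr real I" using I by (intro powr_mono) auto
  also have "\<dots> = 2 ^ I" by (simp add: powr_realpow)
  finally have I2: "\<nu> \<le> 2 ^ I" .
  have e0: "0 < e" using \<nu> by (simp add: e_def)
  have "e \<le> \<nu> powr (- 1 / \<beta>) / \<nu>" unfolding e_def using I2 \<nu> by (intro divide_left_mono) auto
  also have "\<dots> = \<nu> powr (- 1 / \<beta> - 1)" using \<nu> by (simp add: powr_diff)
  also have "\<dots> \<le> \<nu> powr (- 3 / \<beta> / 2)" using \<nu> \<beta> by (intro powr_mono) (auto simp: field_simps)
  finally have "e\<^sup>2 \<le> (\<nu> powr (- 3 / \<beta> / 2))\<^sup>2" using e0 by (intro power_mono) auto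
  also have "\<dots> = \<nu> powr (- 3 / \<beta>)" using \<nu> by (simp add: power2_eq_square flip: powr_add)
  finally have "e\<^sup>2 / \<nu> \<le> \<nu> powr (- 3 / \<beta>) / \<nu>" using \<nu> by (intro divide_right_mono) auto
  also have "\<dots> = \<nu> powr (- 1 - 3 / \<beta>)" using \<nu> by (simp add: powr_diff powr_minus_divide)
  finally show thesis using that[OF e0 I(1) _ I(3)] by (simp add: e_def)
qed

text \<open>The terms decrease geometrically from the coarsest scale j = I downwards with ratio 2
  powr (\<beta> - 3), and the term j = I is \<nu> powr (- (3 - \<beta>) / \<beta>).\<close>

lemma scale_cost_less_3:
  assumes \<beta>: "1 \<le> \<beta>" "\<beta> < 3" and \<nu>: "1 < \<nu>"
  shows "\<exists>e I. 0 < e \<and> 1 \<le> I \<and> e * 2 ^ I = \<nu> powr (- 1 / \<beta>) \<and>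
    scale_cost \<beta> \<nu> e I \<le> (1 + 1 / (1 - 2 powr (\<beta> - 3))) * \<nu> powr (- 1 - 3 / \<beta>)"
proof -
  obtain e I where e: "0 < e" "1 \<le> I" "e * 2 ^ I = \<nu> powr (- 1 / \<beta>)" "real I \<le> log 2 \<nu> + 1"
    "e\<^sup>2 / \<nu> \<le> \<nu> powr (- 1 - 3 / \<beta>)" using scales_upto_3[OF \<beta>(1) \<nu>] by blast
  define r where "r = (2::real) powr (\<beta> - 3)"
  have "2 powr (\<beta> - 3) < (2::real) powr 0" using \<beta> by (intro powr_less_mono) auto
  then have r: "0 < r" "r < 1" by (auto simp: r_def)
  have "(e * 2 ^ j) powr (3 - \<beta>) = \<nu> powr (- 1 / \<beta> * (3 - \<beta>)) * r ^ (I - j)" if "j \<le> I" for j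
  proof -
    have "(2::real) ^ I = 2 ^ (I - j) * 2 ^ j" using that by (simp flip: power_add)
    then have "e * 2 ^ j = \<nu> powr (- 1 / \<beta>) / 2 ^ (I - j)" using e(3) by (simp add: field_simps)
    then have "(e * 2 ^ j) powr (3 - \<beta>) = \<nu> powr (- 1 / \<beta> * (3 - \<beta>)) / (2 ^ (I - j)) powr (3 - \<beta>)"
      by (simp only: powr_divide powr_powr)
    also have "(2 ^ (I - j)) powr (3 - \<beta>) = (2 powr (3 - \<beta>)) ^ (I - j)"
      by (simp add: powr_powr mult.commute flip: powr_realpow)
    also have "2 powr (3 - \<beta>) = inverse r" by (simp add: r_def flip: powr_minus)
    finally show ?thesis by (simp add: power_inverse divide_inverse)
  qed
  then have "(\<Sum>j=1..I. (e * 2 ^ j) powr (3 - \<beta>)) = \<nu> powr (- 1 / \<beta> * (3 - \<beta>)) * (\<Sum>j=1..I. r ^ (I - j))"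
    by (simp add: sum_distrib_left)
  also have "\<dots> \<le> \<nu> powr (- 1 / \<beta> * (3 - \<beta>)) * (1 / (1 - r))"
    by (intro mult_left_mono sum_geometric_rev_le r) auto
  finally have "(\<Sum>j=1..I. (e * 2 ^ j) powr (3 - \<beta>)) / \<nu>\<^sup>2 \<le> \<nu> powr (- 1 / \<beta> * (3 - \<beta>)) * (1 / (1 - r)) / \<nu>\<^sup>2"
    by (intro divide_right_mono) auto
  also have "\<dots> = 1 / (1 - r) * (\<nu> powr (- 1 / \<beta> * (3 - \<beta>)) / \<nu> powr 2)" using \<nu> by simp
  also have "\<nu> powr (- 1 / \<beta> * (3 - \<beta>)) / \<nu> powr 2 = \<nu> powr (- 1 / \<beta> * (3 - \<beta>) - 2)"
    by (simp only: powr_diff)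
  also have "- 1 / \<beta> * (3 - \<beta>) - 2 = - 1 - 3 / \<beta>" using \<beta> by (simp add: field_simps)
  finally have "scale_cost \<beta> \<nu> e I \<le> \<nu> powr (- 1 - 3 / \<beta>) + 1 / (1 - r) * \<nu> powr (- 1 - 3 / \<beta>)"
    unfolding scale_cost_def using e(5) by linarith
  then show ?thesis using e unfolding r_def by (intro exI[of _ e] exI[of _ I]) (simp add: algebra_simps)
qed

lemma scale_cost_eq_3:
  assumes \<nu>: "1 < \<nu>"
  shows "\<exists>e I. 0 < e \<and> 1 \<le> I \<and> e * 2 ^ I = \<nu> powr (- 1 / 3) \<and>
    scale_cost 3 \<nu> e I \<le> (2 + log 2 \<nu>) * \<nu> powr (- 2)"
proof -
  obtain e I where e: "0 < e" "1 \<le> I" "e * 2 ^ I = \<nu> powr (- 1 / 3)" "real I \<le> log 2 \<nu> + 1"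
    "e\<^sup>2 / \<nu> \<le> \<nu> powr (- 1 - 3 / 3)" using scales_upto_3[of 3 \<nu>] \<nu> by auto
  have "(\<Sum>j=1..I. (e * 2 ^ j) powr (3 - 3)) = real I" using e by simp
  then have "scale_cost 3 \<nu> e I \<le> \<nu> powr (- 2) + real I / \<nu>\<^sup>2"
    using e(5) by (simp add: scale_cost_def)
  also have "real I / \<nu>\<^sup>2 = real I * \<nu> powr (- 2)" using \<nu> by (simp add: powr_minus_divide)
  also have "\<dots> \<le> (log 2 \<nu> + 1) * \<nu> powr (- 2)" using e by (intro mult_right_mono) auto
  finally show ?thesis using e by (intro exI[of _ e] exI[of _ I]) (simp add: algebra_simps)
qed

lemma scale_cost_greater_3:
  assumes \<beta>: "3 < \<beta>" and \<nu>: "1 < \<nu>"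
  shows "\<exists>e I. 0 < e \<and> 1 \<le> I \<and> e * 2 ^ I = \<nu> powr (- 1 / \<beta>) \<and>
    scale_cost \<beta> \<nu> e I \<le> (1 + 1 / (1 - 2 powr (3 - \<beta>))) * \<nu> powr (- 1 - 2 / (\<beta> - 1))"
proof -
  define h where "h = \<nu> powr (- 1 / \<beta>)"
  \<comment> \<open>The scale at which e^2 / \<nu> and e powr (3 - \<beta>) / \<nu>^2 agree. Halving
    h until \<eta> is passed gives \<eta> / 2 < e \<le> \<eta>, and \<eta> < h ensures at least one
    halving.\<close>
  define \<eta> where "\<eta> = \<nu> powr (- 1 / (\<beta> - 1))"
  define I where "I = (LEAST i. h / 2 ^ i \<le> \<eta>)"
  define e where "e = h / 2 ^ I"
  have pos: "0 < h" "0 < \<eta>" using \<nu> by (auto simp: h_def \<eta>_def)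
  have "\<eta> < h" unfolding h_def \<eta>_def using \<nu> \<beta> by (intro powr_less_mono) (auto simp: field_simps)
  obtain i0 where "h / \<eta> < 2 ^ i0" using real_arch_pow[of 2 "h / \<eta>"] by auto
  then have "h / 2 ^ i0 \<le> \<eta>" using pos by (simp add: field_simps)
  then have e\<eta>: "e \<le> \<eta>" unfolding e_def I_def by (rule LeastI)
  have "I \<noteq> 0"
  proof
    assume "I = 0"
    then have "e = h" by (simp add: e_def)
    then show False using e\<eta> \<open>\<eta> < h\<close> by simp
  qed
  then have "\<not> h / 2 ^ (I - 1) \<le> \<eta>" unfolding I_def by (intro not_less_Least) auto
  moreover have "(2::real) ^ I = 2 * 2 ^ (I - 1)" using \<open>I \<noteq> 0\<close> by (metis power_eq_if)
  ultimately have 2: "\<eta> < 2 * e" by (simp add: e_def)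
  have e0: "0 < e" using pos by (simp add: e_def)
  define r where "r = (2::real) powr (3 - \<beta>)"
  have "2 powr (3 - \<beta>) < (2::real) powr 0" using \<beta> by (intro powr_less_mono) auto
  then have r: "0 < r" "r < 1" by (auto simp: r_def)
  have "(e * 2 ^ j) powr (3 - \<beta>) \<le> \<eta> powr (3 - \<beta>) * r ^ (j - 1)" if "1 \<le> j" for j
  proof -
    have "e * 2 ^ j = (2 * e) * 2 ^ (j - 1)" using that by (cases j) auto
    then have "(e * 2 ^ j) powr (3 - \<beta>) = (2 * e) powr (3 - \<beta>) * (2 ^ (j - 1)) powr (3 - \<beta>)"
      using e0 by (simp only: powr_mult)
    also have "(2 ^ (j - 1)) powr (3 - \<beta>) = r ^ (j - 1)"
      by (simp add: r_def powr_powr mult.commute flip: powr_realpow)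
    also have "(2 * e) powr (3 - \<beta>) \<le> \<eta> powr (3 - \<beta>)"
      using 2 pos \<beta> by (intro powr_mono2') auto
    finally show ?thesis using r by (simp add: mult_right_mono)
  qed
  then have "(\<Sum>j=1..I. (e * 2 ^ j) powr (3 - \<beta>)) \<le> (\<Sum>j=1..I. \<eta> powr (3 - \<beta>) * r ^ (j - 1))"
    by (intro sum_mono) auto
  also have "\<dots> = \<eta> powr (3 - \<beta>) * (\<Sum>j=1..I. r ^ (j - 1))" by (simp add: sum_distrib_left)
  also have "\<dots> \<le> \<eta> powr (3 - \<beta>) * (1 / (1 - r))"
    by (intro mult_left_mono sum_geometric_le r) auto
  finally have "(\<Sum>j=1..I. (e * 2 ^ j) powr (3 - \<beta>)) / \<nu>\<^sup>2 \<le> \<eta> powr (3 - \<beta>) * (1 / (1 - r)) / \<nu>\<^sup>2"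
    by (intro divide_right_mono) auto
  also have "\<dots> = 1 / (1 - r) * (\<nu> powr (- 1 / (\<beta> - 1) * (3 - \<beta>)) / \<nu> powr 2)"
    using \<nu> by (simp add: \<eta>_def powr_powr)
  also have "\<nu> powr (- 1 / (\<beta> - 1) * (3 - \<beta>)) / \<nu> powr 2 = \<nu> powr (- 1 / (\<beta> - 1) * (3 - \<beta>) - 2)"
    by (simp only: powr_diff)
  also have "- 1 / (\<beta> - 1) * (3 - \<beta>) - 2 = - 1 - 2 / (\<beta> - 1)" using \<beta> by (simp add: field_simps)
  finally have s: "(\<Sum>j=1..I. (e * 2 ^ j) powr (3 - \<beta>)) / \<nu>\<^sup>2 \<le> 1 / (1 - r) * \<nu> powr (- 1 - 2 / (\<beta> - 1))" .
  have "e\<^sup>2 / \<nu> \<le> \<eta>\<^sup>2 / \<nu>" using e0 e\<eta> \<nu> by (intro divide_right_mono power_mono) auto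
  also have "\<eta>\<^sup>2 = \<nu> powr (- 1 / (\<beta> - 1) + - 1 / (\<beta> - 1))"
    by (simp only: \<eta>_def power2_eq_square powr_add)
  also have "\<dots> / \<nu> = \<nu> powr (- 1 / (\<beta> - 1) + - 1 / (\<beta> - 1) - 1)" using \<nu> by (simp add: powr_diff)
  also have "- 1 / (\<beta> - 1) + - 1 / (\<beta> - 1) - 1 = - 1 - 2 / (\<beta> - 1)" by simp
  finally have "scale_cost \<beta> \<nu> e I \<le> \<nu> powr (- 1 - 2 / (\<beta> - 1)) + 1 / (1 - r) * \<nu> powr (- 1 - 2 / (\<beta> - 1))"
    unfolding scale_cost_def using s by linarith
  then show ?thesis using e0 \<open>I \<noteq> 0\<close> unfolding r_def
    by (intro exI[of _ e] exI[of _ I]) (simp add: algebra_simps e_def h_def)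
qed

text \<open>The factor ln (real n) accounts for the number of evaluation points and K for the number
  of nodes spent per unit of \<nu>. The final error is of the order of the square root of this
  product.\<close>

lemma scale_cost_rate:
  fixes \<beta> K :: real
  assumes \<beta>: "1 \<le> \<beta>" and K: "1 \<le> K"
  shows "\<exists>D\<ge>0. \<forall>n. K < real n \<longrightarrow> 2 \<le> n \<longrightarrow> (\<exists>e I. 0 < e \<and> 1 \<le> I \<and>
    e * 2 ^ I = (real n / K) powr (- 1 / \<beta>) \<and>
    scale_cost \<beta> (real n / K) e I * ln (real n) \<le> D * (quadrature_rate \<beta> n)\<^sup>2)"
proof -
  have sq: "(ln (real n) powr (1 / 2))\<^sup>2 = ln (real n)" if "2 \<le> n" for n
    using that by (simp add: powr_half_sqrt)
  consider "\<beta> < 3" | "\<beta> = 3" | "\<beta> > 3" by linarith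
  then show ?thesis
  proof cases
    case 1
    define D where "D = 1 + 1 / (1 - (2::real) powr (\<beta> - 3))"
    have "2 powr (\<beta> - 3) < (2::real) powr 0" using 1 by (intro powr_less_mono) auto
    then have D: "0 \<le> D" unfolding D_def by (intro add_nonneg_nonneg) auto
    show ?thesis
    proof (rule exI[of _ "D * K powr (1 + 3 / \<beta>)"], intro conjI allI impI)
      show "0 \<le> D * K powr (1 + 3 / \<beta>)" using D by simp
      fix n :: nat assume n: "K < real n" "2 \<le> n"
      then have \<nu>: "1 < real n / K" using K by (simp add: field_simps)
      obtain e I where e: "0 < e" "1 \<le> I" "e * 2 ^ I = (real n / K) powr (- 1 / \<beta>)"
        "scale_cost \<beta> (real n / K) e I \<le> D * (real n / K) powr (- 1 - 3 / \<beta>)"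
        using scale_cost_less_3[OF \<beta> 1 \<nu>] unfolding D_def by blast
      have "(quadrature_rate \<beta> n)\<^sup>2 = real n powr (- 1 - 3 / \<beta>) * ln (real n)"
        using 1 sq[OF n(2)] by (simp add: quadrature_rate_def power_mult_distrib powr_powr flip: powr_numeral)
      moreover have "(real n / K) powr (- 1 - 3 / \<beta>) = K powr (1 + 3 / \<beta>) * real n powr (- 1 - 3 / \<beta>)"
        using K n by (simp add: powr_divide powr_minus_divide field_simps powr_diff powr_add)
      moreover have "scale_cost \<beta> (real n / K) e I * ln (real n) \<le> D * (real n / K) powr (- 1 - 3 / \<beta>) * ln (real n)"
        using e(4) n by (intro mult_right_mono) auto
      ultimately have "scale_cost \<beta> (real n / K) e I * ln (real n) \<le> D * K powr (1 + 3 / \<beta>) * (quadrature_rate \<beta> n)\<^sup>2"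
        by (simp add: mult.assoc)
      then show "\<exists>e I. 0 < e \<and> 1 \<le> I \<and> e * 2 ^ I = (real n / K) powr (- 1 / \<beta>) \<and>
          scale_cost \<beta> (real n / K) e I * ln (real n) \<le> D * K powr (1 + 3 / \<beta>) * (quadrature_rate \<beta> n)\<^sup>2"
        using e by blast
    qed
  next
    case 2
    define D where "D = 3 / (ln 2)\<^sup>2 * K\<^sup>2"
    have ln2: "0 < ln (2::real)" by simp
    show ?thesis
    proof (rule exI[of _ D], intro conjI allI impI)
      show "0 \<le> D" by (simp add: D_def)
      fix n :: nat assume n: "K < real n" "2 \<le> n"
      then have \<nu>: "1 < real n / K" using K by (simp add: field_simps)
      obtain e I where e: "0 < e" "1 \<le> I" "e * 2 ^ I = (real n / K) powr (- 1 / 3)"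
        "scale_cost 3 (real n / K) e I \<le> (2 + log 2 (real n / K)) * (real n / K) powr (- 2)"
        using scale_cost_eq_3[OF \<nu>] by blast
      define L where "L = ln (real n)"
      have L: "ln 2 \<le> L" using n by (simp add: L_def)
      have L0: "0 < L" using less_le_trans[OF ln2 L] .
      have "log 2 (real n / K) \<le> log 2 (real n)" using n K by (intro log_mono) (auto simp: field_simps)
      also have "\<dots> = L / ln 2" by (simp add: L_def log_def)
      finally have "2 + log 2 (real n / K) \<le> 3 * L / ln 2" using L L0 ln2 by (simp add: field_simps)
      then have "scale_cost 3 (real n / K) e I \<le> 3 * L / ln 2 * (real n / K) powr (- 2)"
        using e(4) by (meson mult_right_mono order.trans powr_ge_zero)
      then have "scale_cost 3 (real n / K) e I * L \<le> 3 * L / ln 2 * (real n / K) powr (- 2) * L"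
        by (rule mult_right_mono) (rule less_imp_le[OF L0])
      also have "\<dots> = 3 / ln 2 * (L\<^sup>2 * 1) * (K\<^sup>2 / (real n)\<^sup>2)"
        using n K by (simp add: powr_minus_divide power_divide power2_eq_square)
      \<comment> \<open>The bound obtained so far has L^2, while the square of the stated rate has
        L^3; 1 \<le> L / ln 2 makes up the difference.\<close>
      also have "\<dots> \<le> 3 / ln 2 * (L\<^sup>2 * (L / ln 2)) * (K\<^sup>2 / (real n)\<^sup>2)"
        using L L0 ln2 by (intro mult_right_mono mult_left_mono) auto
      also have "\<dots> = D * (L ^ 3 / (real n)\<^sup>2)"
        by (simp add: D_def power2_eq_square power3_eq_cube)
      also have "L ^ 3 / (real n)\<^sup>2 = (quadrature_rate \<beta> n)\<^sup>2"
      proof -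
        have "(L powr (3 / 2))\<^sup>2 = L powr (3 / 2 + 3 / 2)" by (simp only: power2_eq_square powr_add)
        also have "\<dots> = L ^ 3" using L0 by (simp add: powr_numeral)
        finally have "(L powr (3 / 2))\<^sup>2 = L ^ 3" .
        then show ?thesis using 2 n
          by (simp add: quadrature_rate_def power_mult_distrib powr_minus_divide power_divide L_def)
      qed
      finally show "\<exists>e I. 0 < e \<and> 1 \<le> I \<and> e * 2 ^ I = (real n / K) powr (- 1 / \<beta>) \<and>
          scale_cost \<beta> (real n / K) e I * ln (real n) \<le> D * (quadrature_rate \<beta> n)\<^sup>2"
        using e 2 unfolding L_def by blast
    qed
  next
    case 3
    define D where "D = 1 + 1 / (1 - (2::real) powr (3 - \<beta>))"
    define p where "p = - 1 - 2 / (\<beta> - 1)"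
    have "2 powr (3 - \<beta>) < (2::real) powr 0" using 3 by (intro powr_less_mono) auto
    then have D: "0 \<le> D" unfolding D_def by (intro add_nonneg_nonneg) auto
    show ?thesis
    proof (rule exI[of _ "D * K powr (- p)"], intro conjI allI impI)
      show "0 \<le> D * K powr (- p)" using D by simp
      fix n :: nat assume n: "K < real n" "2 \<le> n"
      then have \<nu>: "1 < real n / K" using K by (simp add: field_simps)
      obtain e I where e: "0 < e" "1 \<le> I" "e * 2 ^ I = (real n / K) powr (- 1 / \<beta>)"
        "scale_cost \<beta> (real n / K) e I \<le> D * (real n / K) powr p"
        using scale_cost_greater_3[OF 3 \<nu>] unfolding D_def p_def by blast
      define a where "a = - (\<beta> + 1) / (2 * (\<beta> - 1))"
      have "2 * a = - ((\<beta> + 1) / (\<beta> - 1))" 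
        unfolding a_def minus_divide_left[symmetric] using 3 by (simp add: frac_eq_eq algebra_simps)
      also have "(\<beta> + 1) / (\<beta> - 1) = 1 + 2 / (\<beta> - 1)" using 3 by (simp add: divide_simps)
      finally have "a + a = p" by (simp add: p_def)
      moreover have "(real n powr a)\<^sup>2 = real n powr (a + a)"
        unfolding power2_eq_square powr_add ..
      ultimately have "(real n powr a)\<^sup>2 = real n powr p" by simp
      then have "(quadrature_rate \<beta> n)\<^sup>2 = real n powr p * ln (real n)"
        using 3 sq[OF n(2)] unfolding a_def by (simp add: quadrature_rate_def power_mult_distrib)
      moreover have "(real n / K) powr p = K powr (- p) * real n powr p"
        using K n by (simp add: powr_divide powr_minus_divide)
      moreover have "scale_cost \<beta> (real n / K) e I * ln (real n) \<le> D * (real n / K) powr p * ln (real n)"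
        using e(4) n by (intro mult_right_mono) auto
      ultimately have "scale_cost \<beta> (real n / K) e I * ln (real n) \<le> D * K powr (- p) * (quadrature_rate \<beta> n)\<^sup>2"
        by (simp add: mult.assoc)
      then show "\<exists>e I. 0 < e \<and> 1 \<le> I \<and> e * 2 ^ I = (real n / K) powr (- 1 / \<beta>) \<and>
          scale_cost \<beta> (real n / K) e I * ln (real n) \<le> D * K powr (- p) * (quadrature_rate \<beta> n)\<^sup>2"
        using e by blast
    qed
  qed
qed

text \<open>The exponent of n is smallest at \<beta> = 1, where it is -2. A discretization error of
  order n^-2 is therefore within the rate for every \<beta>, which fixes the fineness of the net in
  \<open>many_point_error\<close>.\<close>

lemma quadrature_rate_lower:
  assumes \<beta>: "1 \<le> \<beta>" and n: "2 \<le> n"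
  shows "ln 2 powr (3 / 2) / (real n)\<^sup>2 \<le> quadrature_rate \<beta> n"
proof -
  have ln2: "0 < ln (2::real)" "ln (2::real) < 1" using ln_less_self[of "2::real"] ln_2_less_1 by auto
  have aux: "ln 2 powr (3 / 2) / (real n)\<^sup>2 \<le> real n powr p * ln (real n) powr q"
    if "- 2 \<le> p" "0 \<le> q" "q \<le> 3 / 2" for p q
  proof -
    have "ln 2 powr (3 / 2) \<le> ln 2 powr q" using that ln2 by (intro powr_mono') auto
    also have "\<dots> \<le> ln (real n) powr q" using that ln2 n by (intro powr_mono2) auto
    finally have "ln 2 powr (3 / 2) \<le> ln (real n) powr q" .
    moreover have "real n powr (- 2) \<le> real n powr p" using that n by (intro powr_mono) auto
    ultimately have "real n powr (- 2) * ln 2 powr (3 / 2) \<le> real n powr p * ln (real n) powr q"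
      by (intro mult_mono) auto
    moreover have "real n powr (- 2) = 1 / (real n)\<^sup>2" using n by (simp add: powr_minus_divide)
    ultimately show ?thesis by simp
  qed
  have "- 2 \<le> - 1 / 2 - 3 / (2 * \<beta>)" using \<beta> by (simp add: field_simps)
  moreover have "- 2 \<le> - (\<beta> + 1) / (2 * (\<beta> - 1))" if "\<not> \<beta> < 3" using that by (simp add: field_simps)
  ultimately show ?thesis
    using aux[of "- 1 / 2 - 3 / (2 * \<beta>)" "1 / 2"] aux[of "- 1" "3 / 2"]
      aux[of "- (\<beta> + 1) / (2 * (\<beta> - 1))" "1 / 2"]
    unfolding quadrature_rate_def by (cases "\<beta> < 3"; cases "\<beta> = 3") auto
qed

section \<open>Discretization and the error bound\<close>

context annular_regular
begin

text \<open>\<Phi> is controlled on [0, 2] alone, so measurability is derived on \<Omega>, where N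
  (x - z) stays in that interval, and is extended by the indicator.\<close>

lemma kernel_set_integrable:
  assumes k: "kernel_ok N \<Phi> t l Xr" and x: "x \<in> \<Omega>" and g: "set_integrable \<mu> \<Omega> g"
  shows "set_integrable \<mu> \<Omega> (\<lambda>z. \<Phi> (N (x - z)) * g z)"
proof -
  have cont\<Phi>: "continuous_on {0..2} \<Phi>"
    using k by (intro lipschitz_on_continuous_on[of 1] lipschitz_onI) (auto simp: kernel_ok_def dist_real_def)
  have "continuous_on \<Omega> (\<lambda>z. \<Phi> (N (x - z)))"
    using diameter[OF x] N_nonneg
    by (intro continuous_on_compose2[OF cont\<Phi>]
        continuous_on_compose2[OF is_norm_continuous[OF norm, of UNIV]] continuous_intros) auto
  then have "(\<lambda>z. indicator \<Omega> z *\<^sub>R \<Phi> (N (x - z))) \<in> borel_measurable borel"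
    using \<Omega>_measurable sets_\<mu> by (intro borel_measurable_continuous_on_indicator) auto
  then have m: "(\<lambda>z. indicator \<Omega> z *\<^sub>R \<Phi> (N (x - z))) \<in> borel_measurable \<mu>"
    using measurable_cong_sets[OF sets_\<mu> refl] by blast
  define M where "M = \<bar>\<Phi> 0\<bar> + 2"
  have M: "\<bar>\<Phi> (N (x - z))\<bar> \<le> M" if "z \<in> \<Omega>" for z
    using lipschitz_kernel[OF k x that x x] diameter[OF x that] N_nonneg[of "x - z"]
    by (simp add: N_zero M_def)
  have g': "integrable \<mu> (\<lambda>z. indicator \<Omega> z *\<^sub>R g z)" using g by (simp add: set_integrable_def)
  have "integrable \<mu> (\<lambda>z. (indicator \<Omega> z *\<^sub>R \<Phi> (N (x - z))) * (indicator \<Omega> z *\<^sub>R g z))"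
  proof (rule Bochner_Integration.integrable_bound)
    show "integrable \<mu> (\<lambda>z. M * (indicator \<Omega> z *\<^sub>R g z))" using g' by (intro integrable_mult_right) auto
    show "(\<lambda>z. (indicator \<Omega> z *\<^sub>R \<Phi> (N (x - z))) * (indicator \<Omega> z *\<^sub>R g z)) \<in> borel_measurable \<mu>"
      by (rule borel_measurable_times[OF m borel_measurable_integrable[OF g']])
    show "AE z in \<mu>. norm ((indicator \<Omega> z *\<^sub>R \<Phi> (N (x - z))) * (indicator \<Omega> z *\<^sub>R g z))
        \<le> norm (M * (indicator \<Omega> z *\<^sub>R g z))"
      using M by (intro AE_I2) (auto simp: indicator_def abs_mult M_def intro!: mult_right_mono)
  qed
  moreover have "(indicator \<Omega> z *\<^sub>R \<Phi> (N (x - z))) * (indicator \<Omega> z *\<^sub>R g z)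
      = indicator \<Omega> z *\<^sub>R (\<Phi> (N (x - z)) * g z)" for z
    by (simp add: indicator_def)
  ultimately show ?thesis by (simp only: set_integrable_def)
qed

lemma cell_error:
  assumes k: "kernel_ok N \<Phi> t l Xr" and x: "x \<in> \<Omega>" and g: "set_integrable \<mu> \<Omega> g"
    and A: "A \<in> sets \<mu>" "A \<subseteq> \<Omega>" and p: "p \<in> \<Omega>" and \<epsilon>: "\<And>z. z \<in> A \<Longrightarrow> N (z - p) \<le> \<epsilon>"
  shows "\<bar>(LINT z:A|\<mu>. \<Phi> (N (x - z)) * g z) - (LINT z:A|\<mu>. g z) * \<Phi> (N (x - p))\<bar>
    \<le> \<epsilon> * (LINT z:A|\<mu>. \<bar>g z\<bar>)"
proof -
  have gA: "set_integrable \<mu> A g" by (rule set_integrable_subset[OF g A])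
  have kA: "set_integrable \<mu> A (\<lambda>z. \<Phi> (N (x - z)) * g z)"
    by (rule set_integrable_subset[OF kernel_set_integrable[OF k x g] A])
  have cA: "set_integrable \<mu> A (\<lambda>z. \<Phi> (N (x - p)) * g z)" using gA by simp
  have "(LINT z:A|\<mu>. \<Phi> (N (x - z)) * g z) - (LINT z:A|\<mu>. g z) * \<Phi> (N (x - p))
      = (LINT z:A|\<mu>. \<Phi> (N (x - z)) * g z - \<Phi> (N (x - p)) * g z)"
    using set_integral_diff(2)[OF kA cA] by simp
  also have "\<bar>\<dots>\<bar> \<le> (LINT z:A|\<mu>. \<bar>\<Phi> (N (x - z)) * g z - \<Phi> (N (x - p)) * g z\<bar>)"
    using set_integral_norm_bound[OF set_integral_diff(1)[OF kA cA]] by simp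
  also have "\<dots> \<le> (LINT z:A|\<mu>. \<epsilon> * \<bar>g z\<bar>)"
  proof (rule set_integral_mono)
    show "set_integrable \<mu> A (\<lambda>z. \<bar>\<Phi> (N (x - z)) * g z - \<Phi> (N (x - p)) * g z\<bar>)"
      by (intro set_integrable_abs set_integral_diff kA cA)
    show "set_integrable \<mu> A (\<lambda>z. \<epsilon> * \<bar>g z\<bar>)" using set_integrable_abs[OF gA] by simp
    fix z assume z: "z \<in> A"
    then have "\<bar>\<Phi> (N (x - z)) - \<Phi> (N (x - p))\<bar> \<le> \<epsilon>"
      using lipschitz_kernel[OF k x _ x p, of z] N_abs_diff[of x z p] \<epsilon>[OF z] A by force
    then show "\<bar>\<Phi> (N (x - z)) * g z - \<Phi> (N (x - p)) * g z\<bar> \<le> \<epsilon> * \<bar>g z\<bar>"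
      by (simp add: abs_mult mult_right_mono flip: left_diff_distrib)
  qed
  finally show ?thesis by simp
qed

text \<open>Induction over the net with A arbitrary: the part of A within \<epsilon> of p becomes
  the cell of p, and the rest of A is left to the other points. The cells are thus disjoint, and
  since each weight is the integral of g over its cell, the total weight is at most the L^1
  norm.\<close>

lemma discretization:
  assumes k: "kernel_ok N \<Phi> t l Xr" and g: "set_integrable \<mu> \<Omega> g"
    and "finite P" "P \<subseteq> \<Omega>" "A \<in> sets \<mu>" "A \<subseteq> \<Omega>" "\<And>z. z \<in> A \<Longrightarrow> \<exists>p\<in>P. N (z - p) \<le> \<epsilon>"
  shows "\<exists>w. (\<Sum>p\<in>P. \<bar>w p\<bar>) \<le> (LINT z:A|\<mu>. \<bar>g z\<bar>) \<and>
    (\<forall>x\<in>\<Omega>. \<bar>(LINT z:A|\<mu>. \<Phi> (N (x - z)) * g z) - (\<Sum>p\<in>P. w p * \<Phi> (N (x - p)))\<bar>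
      \<le> \<epsilon> * (LINT z:A|\<mu>. \<bar>g z\<bar>))"
  using assms(3-)
proof (induction P arbitrary: A rule: finite_induct)
  case empty
  then have "A = {}" by blast
  then show ?case by (simp add: set_lebesgue_integral_def)
next
  case (insert p P)
  define D where "D = A \<inter> {z. N (z - p) \<le> \<epsilon>}"
  have "closed {z. N (z - p) \<le> \<epsilon>}"
    by (intro closed_Collect_le continuous_intros
        continuous_on_compose2[OF is_norm_continuous[OF norm, of UNIV]]) auto
  then have D: "D \<in> sets \<mu>" "D \<subseteq> \<Omega>" using insert.prems unfolding D_def sets_\<mu> by auto
  have E: "A - D \<in> sets \<mu>" "A - D \<subseteq> \<Omega>" using insert.prems D by auto
  have "\<exists>q\<in>P. N (z - q) \<le> \<epsilon>" if "z \<in> A - D" for z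
    using insert.prems(4)[of z] that by (auto simp: D_def)
  then obtain w where w: "(\<Sum>p\<in>P. \<bar>w p\<bar>) \<le> (LINT z:A - D|\<mu>. \<bar>g z\<bar>)"
    "\<And>x. x \<in> \<Omega> \<Longrightarrow> \<bar>(LINT z:A - D|\<mu>. \<Phi> (N (x - z)) * g z) - (\<Sum>p\<in>P. w p * \<Phi> (N (x - p)))\<bar>
      \<le> \<epsilon> * (LINT z:A - D|\<mu>. \<bar>g z\<bar>)"
    using insert.IH[of "A - D"] insert.prems(1) E by blast
  have split: "(LINT z:A|\<mu>. f z) = (LINT z:A - D|\<mu>. f z) + (LINT z:D|\<mu>. f z)"
    if f: "set_integrable \<mu> \<Omega> f" for f :: "'a \<Rightarrow> real"
  proof -
    have "A = (A - D) \<union> D" by (auto simp: D_def)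
    then show ?thesis
      using set_integral_Un[of "A - D" D \<mu> f] set_integrable_subset[OF f D] set_integrable_subset[OF f E]
      by auto
  qed
  define v where "v = (LINT z:D|\<mu>. g z)"
  define w' where "w' q = (if q = p then v else w q)" for q
  have w': "(\<Sum>q\<in>P. w' q * f q) = (\<Sum>q\<in>P. w q * f q)" "(\<Sum>q\<in>P. \<bar>w' q\<bar>) = (\<Sum>q\<in>P. \<bar>w q\<bar>)" for f
    using insert.hyps by (auto simp: w'_def intro!: sum.cong)
  have "\<bar>v\<bar> \<le> (LINT z:D|\<mu>. \<bar>g z\<bar>)"
    using set_integral_norm_bound[OF set_integrable_subset[OF g D]] by (simp add: v_def)
  then have "(\<Sum>q\<in>insert p P. \<bar>w' q\<bar>) \<le> (LINT z:A|\<mu>. \<bar>g z\<bar>)"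
    using w(1) insert.hyps by (simp add: w' split[OF set_integrable_abs[OF g]]) (simp add: w'_def)
  moreover have "\<bar>(LINT z:A|\<mu>. \<Phi> (N (x - z)) * g z) - (\<Sum>q\<in>insert p P. w' q * \<Phi> (N (x - q)))\<bar>
      \<le> \<epsilon> * (LINT z:A|\<mu>. \<bar>g z\<bar>)" if x: "x \<in> \<Omega>" for x
  proof -
    have "\<bar>(LINT z:D|\<mu>. \<Phi> (N (x - z)) * g z) - v * \<Phi> (N (x - p))\<bar> \<le> \<epsilon> * (LINT z:D|\<mu>. \<bar>g z\<bar>)"
      unfolding v_def using insert.prems(1) by (intro cell_error[OF k x g D]) (auto simp: D_def)
    moreover have "(\<Sum>q\<in>insert p P. w' q * \<Phi> (N (x - q))) = v * \<Phi> (N (x - p)) + (\<Sum>q\<in>P. w q * \<Phi> (N (x - q)))"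
      using insert.hyps by (simp add: w'(1)) (simp add: w'_def)
    ultimately show ?thesis using w(2)[OF x]
      unfolding split[OF kernel_set_integrable[OF k x g]] split[OF set_integrable_abs[OF g]] distrib_left
      by linarith
  qed
  ultimately show ?case by blast
qed

text \<open>For the bounded range of n that is too small for the multiscale argument: one node
  carries the whole integral of g, and the diameter 2 of \<Omega> bounds the error.\<close>

lemma one_point_error:
  assumes k: "kernel_ok N \<Phi> t l Xr" and g: "set_integrable \<mu> \<Omega> g" "(LINT z:\<Omega>|\<mu>. \<bar>g z\<bar>) = 1" and n: "1 \<le> (n::nat)"
  shows "\<exists>y lam. (\<forall>k\<in>{1..n}. y k \<in> \<Omega>) \<and>
    (\<forall>x\<in>\<Omega>. \<bar>(LINT z:\<Omega>|\<mu>. \<Phi> (N (x - z)) * g z) - (\<Sum>k=1..n. lam k * \<Phi> (N (x - y k)))\<bar> \<le> 2)"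
proof -
  obtain p where p: "p \<in> \<Omega>" using \<Omega>_nonempty by blast
  define lam where "lam k = (if k = 1 then LINT z:\<Omega>|\<mu>. g z else 0)" for k :: nat
  have "(\<Sum>k=1..n. lam k * \<Phi> (N (x - p))) = (LINT z:\<Omega>|\<mu>. g z) * \<Phi> (N (x - p))" for x
    using n by (simp add: lam_def if_distrib[of "\<lambda>c. c * _"] sum.delta cong: if_cong)
  moreover have "\<bar>(LINT z:\<Omega>|\<mu>. \<Phi> (N (x - z)) * g z) - (LINT z:\<Omega>|\<mu>. g z) * \<Phi> (N (x - p))\<bar> \<le> 2" if "x \<in> \<Omega>" for x
    using cell_error[OF k that g(1) \<Omega>_measurable order.refl p diameter[OF _ p]] g(2) by simp
  ultimately show ?thesis using p by (intro exI[of _ "\<lambda>_. p"] exI[of _ lam]) auto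
qed

text \<open>Passes from the net to all of \<Omega>. It is applied to the discretized integral and to
  the compressed sum, which is why \<open>finite_quadrature\<close> also bounds the total weight of
  \<open>lam\<close>.\<close>

lemma weighted_kernel_lipschitz:
  assumes k: "kernel_ok N \<Phi> t l Xr" and S: "S \<subseteq> \<Omega>" and w: "(\<Sum>y\<in>S. \<bar>w y\<bar>) \<le> 1"
    and x: "x \<in> \<Omega>" "x' \<in> \<Omega>" "N (x - x') \<le> \<epsilon>"
  shows "\<bar>(\<Sum>y\<in>S. w y * \<Phi> (N (x - y))) - (\<Sum>y\<in>S. w y * \<Phi> (N (x' - y)))\<bar> \<le> \<epsilon>"
proof -
  have \<epsilon>: "0 \<le> \<epsilon>" using N_nonneg[of "x - x'"] x by linarith
  have "\<bar>(\<Sum>y\<in>S. w y * \<Phi> (N (x - y))) - (\<Sum>y\<in>S. w y * \<Phi> (N (x' - y)))\<bar>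
      = \<bar>\<Sum>y\<in>S. w y * (\<Phi> (N (x - y)) - \<Phi> (N (x' - y)))\<bar>"
    by (simp add: right_diff_distrib sum_subtractf)
  also have "\<dots> \<le> (\<Sum>y\<in>S. \<bar>w y\<bar> * \<epsilon>)"
  proof (rule order.trans[OF sum_abs], rule sum_mono)
    fix y assume "y \<in> S"
    then have "\<bar>\<Phi> (N (x - y)) - \<Phi> (N (x' - y))\<bar> \<le> \<bar>N (x - y) - N (x' - y)\<bar>"
      using S x by (intro lipschitz_kernel[OF k]) auto
    also have "\<dots> \<le> \<epsilon>" using N_abs_diff'[of x y x'] x(3) by linarith
    finally show "\<bar>w y * (\<Phi> (N (x - y)) - \<Phi> (N (x' - y)))\<bar> \<le> \<bar>w y\<bar> * \<epsilon>"
      by (simp add: abs_mult mult_left_mono)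
  qed
  also have "\<dots> = (\<Sum>y\<in>S. \<bar>w y\<bar>) * \<epsilon>" by (simp add: sum_distrib_right)
  also have "\<dots> \<le> 1 * \<epsilon>" using w \<epsilon> by (intro mult_right_mono)
  finally show ?thesis by simp
qed

lemma many_point_error:
  assumes k: "kernel_ok N \<Phi> t l Xr" and B: "finite B" "fun_vs.span B = Xr"
    and g: "set_integrable \<mu> \<Omega> g" "(LINT z:\<Omega>|\<mu>. \<bar>g z\<bar>) = 1" and n: "2 \<le> n"
    and \<nu>: "1 < \<nu>" "(real (card B) + 2) * ((2 + c4 * 2 powr \<beta>) * \<nu>) \<le> real n"
    and e: "e > 0" and I: "1 \<le> I" "e * 2 ^ I = \<nu> powr (- 1 / \<beta>)" and V: "V > 0"
    and var: "4 * (4 * e\<^sup>2 / \<nu> + 2 * var_const (t ` {..l}) * (\<Sum>j=1..I. (e * 2 ^ j) powr (3 - \<beta>)) / \<nu>\<^sup>2) \<le> V"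
  shows "\<exists>y lam. (\<forall>k\<in>{1..n}. y k \<in> \<Omega>) \<and>
    (\<forall>x\<in>\<Omega>. \<bar>(LINT z:\<Omega>|\<mu>. \<Phi> (N (x - z)) * g z) - (\<Sum>k=1..n. lam k * \<Phi> (N (x - y k)))\<bar>
      \<le> 3 / (real n)\<^sup>2 + sqrt (2 * V * ln (2 * (c4 * (2 * (real n)\<^sup>2) powr \<beta>))))"
proof -
  \<comment> \<open>A single net S of this fineness provides both the candidate nodes and the
    evaluation points. Its size is polynomial in n, so its logarithm is of order log n.\<close>
  define \<epsilon> where "\<epsilon> = 1 / (real n)\<^sup>2"
  have n1: "1 \<le> (real n)\<^sup>2" using n by (intro one_le_power) auto
  then have "\<epsilon> \<le> 1" unfolding \<epsilon>_def using n by (intro divide_le_eq_1_pos[THEN iffD2]) auto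
  then have \<epsilon>4: "\<epsilon> \<le> 4" by simp
  have \<epsilon>: "0 < \<epsilon>" "2 / \<epsilon> = 2 * (real n)\<^sup>2" using n by (auto simp: \<epsilon>_def)
  obtain S where S: "finite S" "S \<subseteq> \<Omega>" "real (card S) \<le> c4 * (2 / \<epsilon>) powr \<beta>"
    "\<And>y. y \<in> \<Omega> \<Longrightarrow> \<exists>x\<in>S. N (y - x) < \<epsilon>" using net_exists[OF \<epsilon>(1) \<epsilon>4] by metis
  have S0: "S \<noteq> {}" using S(4) \<Omega>_nonempty by blast
  have cover: "\<exists>p\<in>S. N (z - p) \<le> \<epsilon>" if "z \<in> \<Omega>" for z using S(4)[OF that] by (auto intro: less_imp_le)
  obtain w where w: "(\<Sum>p\<in>S. \<bar>w p\<bar>) \<le> 1"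
    "\<And>x. x \<in> \<Omega> \<Longrightarrow> \<bar>(LINT z:\<Omega>|\<mu>. \<Phi> (N (x - z)) * g z) - (\<Sum>p\<in>S. w p * \<Phi> (N (x - p)))\<bar> \<le> \<epsilon>"
    using discretization[OF k g(1) S(1,2) \<Omega>_measurable order.refl cover] g(2) by auto
  have "\<nu> powr (- 1 / \<beta>) \<le> \<nu> powr 0" using \<nu> params by (intro powr_mono) auto
  then have I4: "e * 2 ^ I \<le> 4" using I \<nu> by simp
  have \<nu>0: "0 < \<nu>" using \<nu> by simp
  obtain lam Y where lam: "Y \<subseteq> S" "real (card Y) \<le> (real (card B) + 2) * ((2 + c4 * 2 powr \<beta>) * \<nu>)"
    "\<forall>y. lam y \<noteq> 0 \<longrightarrow> y \<in> Y" "(\<Sum>y\<in>S. \<bar>lam y\<bar>) \<le> 1"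
    "\<forall>x\<in>S. \<bar>(\<Sum>y\<in>S. w y * \<Phi> (N (x - y))) - (\<Sum>y\<in>S. lam y * \<Phi> (N (x - y)))\<bar> \<le> sqrt (2 * V * ln (2 * real (card S)))"
    using finite_quadrature[OF k B S(1,2) w(1) \<nu>0 e I I4 S(1) S0 S(2) V var] by blast
  have Y: "finite Y" "Y \<subseteq> \<Omega>" "card Y \<le> n" using lam(1,2) \<nu>(2) S finite_subset by auto
  define E where "E = sqrt (2 * V * ln (2 * (c4 * (2 * (real n)\<^sup>2) powr \<beta>)))"
  have "real (card S) > 0" using S(1) S0 by (simp add: card_gt_0_iff)
  then have E: "sqrt (2 * V * ln (2 * real (card S))) \<le> E"
    unfolding E_def using S(3) V \<epsilon>(2) by (intro real_sqrt_le_mono mult_left_mono) auto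
  \<comment> \<open>One \<epsilon> comes from the discretization and two from moving x to the net,
    once in each of the two sums.\<close>
  have err: "\<bar>(LINT z:\<Omega>|\<mu>. \<Phi> (N (x - z)) * g z) - (\<Sum>y\<in>S. lam y * \<Phi> (N (x - y)))\<bar> \<le> 3 * \<epsilon> + E"
    if x: "x \<in> \<Omega>" for x
  proof -
    obtain x' where x': "x' \<in> S" "N (x - x') \<le> \<epsilon>" using cover[OF x] by blast
    have x'\<Omega>: "x' \<in> \<Omega>" using x' S by blast
    show ?thesis
      using w(2)[OF x] weighted_kernel_lipschitz[OF k S(2) w(1) x x'\<Omega> x'(2)]
        weighted_kernel_lipschitz[OF k S(2) lam(4) x x'\<Omega> x'(2)] bspec[OF lam(5) x'(1)] E
      by linarith
  qed
  obtain p where p: "p \<in> \<Omega>" using \<Omega>_nonempty by blast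
  obtain h where h: "bij_betw h {1..card Y} Y" using ex_bij_betw_nat_finite_1[OF Y(1)] by blast
  \<comment> \<open>Fewer than n nodes may have been produced; the rest of the list is filled with p
    at weight zero.\<close>
  define y where "y i = (if i \<in> {1..card Y} then h i else p)" for i
  define c where "c i = (if i \<in> {1..card Y} then lam (h i) else 0)" for i
  have "y i \<in> \<Omega>" for i
    using bij_betwE[OF h] Y(2) p by (auto simp: y_def)
  moreover have "(\<Sum>i=1..n. c i * \<Phi> (N (x - y i))) = (\<Sum>y\<in>S. lam y * \<Phi> (N (x - y)))" for x
  proof -
    have "(\<Sum>i=1..n. c i * \<Phi> (N (x - y i))) = (\<Sum>i=1..card Y. c i * \<Phi> (N (x - y i)))"
      using Y(3) by (intro sum.mono_neutral_right) (auto simp: c_def)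
    also have "\<dots> = (\<Sum>i=1..card Y. lam (h i) * \<Phi> (N (x - h i)))"
      by (intro sum.cong) (auto simp: c_def y_def)
    also have "\<dots> = (\<Sum>y\<in>Y. lam y * \<Phi> (N (x - y)))"
      by (rule sum.reindex_bij_betw[OF h])
    also have "\<dots> = (\<Sum>y\<in>S. lam y * \<Phi> (N (x - y)))"
      using lam(1,3) S(1) by (intro sum.mono_neutral_left) auto
    finally show ?thesis .
  qed
  ultimately show ?thesis
    using err unfolding E_def \<epsilon>_def by (intro exI[of _ y] exI[of _ c]) auto
qed

lemma var_const_le:
  "var_const (t ` {..l}) \<le> 24 * (real l + 1) * (2 * c5 + c4 * 3 powr \<beta> + 2) * c4 * 4 powr \<beta>"
proof -
  have "card (t ` {..l}) \<le> l + 1" using card_image_le[of "{..l}" t] by simp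
  then have "real (card (t ` {..l})) \<le> real (l + 1)" by (rule of_nat_mono)
  then have "24 * real (card (t ` {..l})) \<le> 24 * (real l + 1)" by simp
  then show ?thesis unfolding var_const_def shell_const_def[symmetric]
    using params shell_const_pos by (intro mult_right_mono) auto
qed

end

section \<open>The constant, and the cases of small and large n\<close>

theorem theorem6p1:
  fixes c4 c5 \<beta> :: real and r l :: nat
  assumes "c4 > 1" and "\<beta> \<ge> 1" and "c5 > 0"
  shows "\<exists>C::real.
    \<forall>(N :: 'a::euclidean_space \<Rightarrow> real) (\<Omega> :: 'a set) (\<mu> :: 'a measure)
     (\<Phi> :: real \<Rightarrow> real) (t :: nat \<Rightarrow> real) (Xr :: ('a \<Rightarrow> real) set) (g :: 'a \<Rightarrow> real).
      is_norm N \<and>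
      compact \<Omega> \<and> \<Omega> \<subseteq> ncball N 0 1 \<and>
      prob_space \<mu> \<and> sets \<mu> = sets borel \<and> emeasure \<mu> (- \<Omega>) = 0 \<and>
      (\<forall>x\<in>\<Omega>. \<forall>\<delta>\<in>{0<..2}.
         inverse c4 * \<delta> powr \<beta> \<le> measure \<mu> (nball N x \<delta>) \<and>
         measure \<mu> (nball N x \<delta>) \<le> c4 * \<delta> powr \<beta>) \<and>
      (\<forall>x\<in>\<Omega>. \<forall>u\<in>{0<..2}. \<forall>s\<in>{0<..2}.
         measure \<mu> {y\<in>\<Omega>. u \<le> N (y - x) \<and> N (y - x) \<le> u + s} \<le> c5 * s) \<and>
      (\<forall>s\<in>{0..2}. \<forall>s'\<in>{0..2}. \<bar>\<Phi> s - \<Phi> s'\<bar> \<le> \<bar>s - s'\<bar>) \<and>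
      t 0 = 0 \<and> t l = 2 \<and> (\<forall>j<l. t j < t (Suc j)) \<and>
      fun_space_of_dim Xr r \<and> translation_invariant Xr \<and>
      (\<forall>f\<in>Xr. continuous_on UNIV f) \<and>
      (\<forall>j\<in>{1..l}. \<exists>f\<in>Xr. \<forall>x. t (j - 1) \<le> N x \<and> N x \<le> t j \<longrightarrow> \<Phi> (N x) = f x) \<and>
      set_integrable \<mu> \<Omega> g \<and> (LINT y:\<Omega>|\<mu>. \<bar>g y\<bar>) = 1
      \<longrightarrow>
      (\<forall>n\<ge>2. \<exists>(y :: nat \<Rightarrow> 'a) (lam :: nat \<Rightarrow> real).
         (\<forall>k\<in>{1..n}. y k \<in> \<Omega>) \<and>
         (SUP x\<in>\<Omega>. ereal \<bar>(LINT z:\<Omega>|\<mu>. \<Phi> (N (x - z)) * g z)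
                      - (\<Sum>k=1..n. lam k * \<Phi> (N (x - y k)))\<bar>)
           \<le> ereal (C * quadrature_rate \<beta> n))"
proof -
  \<comment> \<open>The number of nodes per unit of \<nu>: r + 2 for each of at most (2 + c4 * 2
    powr \<beta>) * \<nu> pieces. Taking \<nu> = n / K spends exactly the n nodes allowed.\<close>
  define K where "K = (real r + 2) * (2 + c4 * 2 powr \<beta>)"
  define vc where "vc = 24 * (real l + 1) * (2 * c5 + c4 * 3 powr \<beta> + 2) * c4 * 4 powr \<beta>"
  define \<theta> where "\<theta> = ln (2::real) powr (3 / 2)"
  \<comment> \<open>Chosen so that CL * ln n dominates the logarithm of twice the bound on the net
    size, c4 * (2 * n^2) powr \<beta>, for all n \<ge> 2.\<close>
  define CL where "CL = ln (2 * c4 * 2 powr \<beta>) / ln 2 + 2 * \<beta>"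
  have ln2: "0 < ln (2::real)" by simp
  have "2 * 2 \<le> (real r + 2) * (2 + c4 * 2 powr \<beta>)" using assms by (intro mult_mono) auto
  then have K: "1 \<le> K" by (simp add: K_def)
  have "0 \<le> c4 * 3 powr \<beta>" using assms by simp
  then have vc: "0 \<le> vc" unfolding vc_def using assms by (intro mult_nonneg_nonneg) auto
  have \<theta>: "0 < \<theta>" using ln2 by (simp add: \<theta>_def)
  obtain D where D: "0 \<le> D" "\<And>n. K < real n \<Longrightarrow> 2 \<le> n \<Longrightarrow> \<exists>e I. 0 < e \<and> 1 \<le> I \<and>
    e * 2 ^ I = (real n / K) powr (- 1 / \<beta>) \<and>
    scale_cost \<beta> (real n / K) e I * ln (real n) \<le> D * (quadrature_rate \<beta> n)\<^sup>2"
    using scale_cost_rate[OF assms(2) K] by blast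
  have "1 \<le> 2 * c4 * 2 powr \<beta>"
    using assms mult_mono[of 1 "2 * c4" 1 "2 powr \<beta>"] ge_one_powr_ge_zero[of 2 \<beta>] by simp
  then have lc: "0 \<le> ln (2 * c4 * 2 powr \<beta>)" by simp
  then have CL: "0 \<le> CL" unfolding CL_def using ln2 assms by (intro add_nonneg_nonneg) auto
  define G where "G = sqrt (2 * (16 + 8 * vc) * CL * D)"
  \<comment> \<open>The first summand serves n \<le> K and the second n > K, where 3 / \<theta>
    covers the discretization and G the balanced sum. Everything here precedes the choice of N,
    \<Omega>, \<mu> and the kernel, so C is uniform in them.\<close>
  define C where "C = 2 * K\<^sup>2 / \<theta> + (3 / \<theta> + G)"
  have G: "0 \<le> G" unfolding G_def using vc CL D by simp
  have main: "\<exists>y lam. (\<forall>k\<in>{1..n}. y k \<in> \<Omega>) \<and>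
      (\<forall>x\<in>\<Omega>. \<bar>(LINT z:\<Omega>|\<mu>. \<Phi> (N (x - z)) * g z) - (\<Sum>k=1..n. lam k * \<Phi> (N (x - y k)))\<bar>
        \<le> C * quadrature_rate \<beta> n)"
    if ar: "annular_regular \<mu> N \<Omega> c4 c5 \<beta>" and k: "kernel_ok N \<Phi> t l Xr"
      and B: "finite B" "card B = r" "fun_vs.span B = Xr"
      and g: "set_integrable \<mu> \<Omega> g" "(LINT y:\<Omega>|\<mu>. \<bar>g y\<bar>) = 1" and n: "2 \<le> n"
    for N :: "'a \<Rightarrow> real" and \<Omega> \<mu> \<Phi> t Xr g B n
  proof -
    interpret annular_regular \<mu> N \<Omega> c4 c5 \<beta> by (rule ar)
    define q where "q = quadrature_rate \<beta> n"
    have q: "\<theta> / (real n)\<^sup>2 \<le> q" unfolding q_def \<theta>_def by (rule quadrature_rate_lower[OF assms(2) n])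
    have q0: "0 \<le> q" using q \<theta> by (meson divide_nonneg_nonneg less_imp_le order.trans zero_le_power2)
    have inv: "1 / (real n)\<^sup>2 \<le> q / \<theta>" using q \<theta> by (simp add: field_simps)
    show ?thesis
    proof (cases "real n \<le> K")
      case True
      have "1 \<le> K\<^sup>2 * (1 / (real n)\<^sup>2)" using True n by (simp add: power_mono)
      also have "\<dots> \<le> K\<^sup>2 * (q / \<theta>)" by (intro mult_left_mono inv) auto
      finally have "2 \<le> 2 * K\<^sup>2 / \<theta> * q" by simp
      also have "\<dots> \<le> C * q" unfolding C_def using G \<theta> q0 by (intro mult_right_mono) auto
      finally have 2: "2 \<le> C * q" .
      obtain y lam where "\<forall>k\<in>{1..n}. y k \<in> \<Omega>"
        "\<forall>x\<in>\<Omega>. \<bar>(LINT z:\<Omega>|\<mu>. \<Phi> (N (x - z)) * g z) - (\<Sum>k=1..n. lam k * \<Phi> (N (x - y k)))\<bar> \<le> 2"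
        using one_point_error[OF k g, of n] n by auto
      then show ?thesis using 2 unfolding q_def by (intro exI[of _ y] exI[of _ lam]) force
    next
      case False
      define \<nu> where "\<nu> = real n / K"
      have \<nu>: "1 < \<nu>" "(real (card B) + 2) * ((2 + c4 * 2 powr \<beta>) * \<nu>) \<le> real n"
      proof -
        show "1 < \<nu>" using False K by (simp add: \<nu>_def)
        have "(real (card B) + 2) * ((2 + c4 * 2 powr \<beta>) * \<nu>) = K * \<nu>" by (simp add: K_def B)
        also have "\<dots> = real n" using K by (simp add: \<nu>_def)
        finally show "(real (card B) + 2) * ((2 + c4 * 2 powr \<beta>) * \<nu>) \<le> real n" by simp
      qed
      obtain e I where e: "0 < e" "1 \<le> I" "e * 2 ^ I = \<nu> powr (- 1 / \<beta>)"
        "scale_cost \<beta> \<nu> e I * ln (real n) \<le> D * q\<^sup>2"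
        using D(2)[of n] False n unfolding \<nu>_def q_def by auto
      \<comment> \<open>16 = 4 * 4 and 8 = 4 * 2 are the numerical factors in hypothesis
        \<open>var\<close> of \<open>many_point_error\<close>. Applying both to the whole of
        \<open>scale_cost\<close> makes V a multiple of it.\<close>
      define V where "V = (16 + 8 * vc) * scale_cost \<beta> \<nu> e I"
      define s where "s = (\<Sum>j=1..I. (e * 2 ^ j) powr (3 - \<beta>)) / \<nu>\<^sup>2"
      have s: "0 \<le> s" unfolding s_def by (intro divide_nonneg_nonneg sum_nonneg) auto
      have sc: "scale_cost \<beta> \<nu> e I = e\<^sup>2 / \<nu> + s" by (simp add: scale_cost_def s_def)
      have ev: "0 < e\<^sup>2 / \<nu>" using e \<nu> by simp
      have V: "0 < V" unfolding V_def sc using vc s ev by (intro mult_pos_pos) auto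
      have "var_const (t ` {..l}) * s \<le> vc * s" unfolding vc_def using var_const_le s by (rule mult_right_mono)
      moreover have "0 \<le> vc * (e\<^sup>2 / \<nu>)" by (intro mult_nonneg_nonneg vc less_imp_le[OF ev])
      ultimately have "16 * (e\<^sup>2 / \<nu>) + 8 * (var_const (t ` {..l}) * s) \<le> V"
        using s unfolding V_def sc distrib_left distrib_right mult.assoc by linarith
      then have var: "4 * (4 * e\<^sup>2 / \<nu> + 2 * var_const (t ` {..l}) * (\<Sum>j=1..I. (e * 2 ^ j) powr (3 - \<beta>)) / \<nu>\<^sup>2) \<le> V"
        by (simp add: s_def)
      have L: "ln (2 * (c4 * (2 * (real n)\<^sup>2) powr \<beta>)) \<le> CL * ln (real n)"
      proof -
        have "ln (2 * (c4 * (2 * (real n)\<^sup>2) powr \<beta>)) = ln (2 * c4 * 2 powr \<beta>) + 2 * \<beta> * ln (real n)"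
          using assms n by (simp add: ln_mult ln_powr powr_mult ln_realpow)
        moreover have "ln (2 * c4 * 2 powr \<beta>) * 1 \<le> ln (2 * c4 * 2 powr \<beta>) * (ln (real n) / ln 2)"
          using lc n ln2 by (intro mult_left_mono) auto
        ultimately show ?thesis by (simp add: CL_def algebra_simps)
      qed
      have "2 * V * ln (2 * (c4 * (2 * (real n)\<^sup>2) powr \<beta>)) \<le> 2 * V * (CL * ln (real n))"
        using L V by (intro mult_left_mono) auto
      also have "\<dots> = 2 * (16 + 8 * vc) * CL * (scale_cost \<beta> \<nu> e I * ln (real n))" by (simp add: V_def)
      also have "\<dots> \<le> 2 * (16 + 8 * vc) * CL * (D * q\<^sup>2)" using e(4) vc CL by (intro mult_left_mono) auto
      finally have "sqrt (2 * V * ln (2 * (c4 * (2 * (real n)\<^sup>2) powr \<beta>))) \<le> sqrt (2 * (16 + 8 * vc) * CL * D * q\<^sup>2)"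
        by (simp add: mult.assoc)
      also have "\<dots> = G * q" using q0 by (simp add: G_def real_sqrt_mult)
      finally have "sqrt (2 * V * ln (2 * (c4 * (2 * (real n)\<^sup>2) powr \<beta>))) \<le> G * q" .
      moreover have "3 / (real n)\<^sup>2 = 3 * (1 / (real n)\<^sup>2)" by simp
      moreover have "(3 / \<theta> + G) * q = 3 * (q / \<theta>) + G * q" by (simp add: distrib_right)
      ultimately have "3 / (real n)\<^sup>2 + sqrt (2 * V * ln (2 * (c4 * (2 * (real n)\<^sup>2) powr \<beta>))) \<le> (3 / \<theta> + G) * q"
        using inv by linarith
      also have "\<dots> \<le> C * q" unfolding C_def using \<theta> q0 by (intro mult_right_mono) auto
      finally have fin: "3 / (real n)\<^sup>2 + sqrt (2 * V * ln (2 * (c4 * (2 * (real n)\<^sup>2) powr \<beta>))) \<le> C * q" .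
      obtain y lam where "\<forall>k\<in>{1..n}. y k \<in> \<Omega>"
        "\<forall>x\<in>\<Omega>. \<bar>(LINT z:\<Omega>|\<mu>. \<Phi> (N (x - z)) * g z) - (\<Sum>k=1..n. lam k * \<Phi> (N (x - y k)))\<bar>
          \<le> 3 / (real n)\<^sup>2 + sqrt (2 * V * ln (2 * (c4 * (2 * (real n)\<^sup>2) powr \<beta>)))"
        using many_point_error[OF k B(1,3) g n \<nu> e(1-3) V var] by blast
      then show ?thesis using fin unfolding q_def by (intro exI[of _ y] exI[of _ lam]) (auto intro: order.trans)
    qed
  qed
  show ?thesis
  proof (rule exI[of _ C], intro allI impI, elim conjE)
    fix N :: "'a \<Rightarrow> real" and \<Omega> :: "'a set" and \<mu> :: "'a measure" and \<Phi> t
      and Xr :: "('a \<Rightarrow> real) set" and g :: "'a \<Rightarrow> real" and n :: nat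
    assume H: "is_norm N" "compact \<Omega>" "\<Omega> \<subseteq> ncball N 0 1" "prob_space \<mu>" "sets \<mu> = sets borel"
      "emeasure \<mu> (- \<Omega>) = 0"
      "\<forall>x\<in>\<Omega>. \<forall>\<delta>\<in>{0<..2}. inverse c4 * \<delta> powr \<beta> \<le> measure \<mu> (nball N x \<delta>) \<and>
         measure \<mu> (nball N x \<delta>) \<le> c4 * \<delta> powr \<beta>"
      "\<forall>x\<in>\<Omega>. \<forall>u\<in>{0<..2}. \<forall>s\<in>{0<..2}.
         measure \<mu> {y\<in>\<Omega>. u \<le> N (y - x) \<and> N (y - x) \<le> u + s} \<le> c5 * s"
      and \<Phi>: "\<forall>s\<in>{0..2}. \<forall>s'\<in>{0..2}. \<bar>\<Phi> s - \<Phi> s'\<bar> \<le> \<bar>s - s'\<bar>" "t 0 = 0" "t l = 2" "\<forall>j<l. t j < t (Suc j)"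
      "translation_invariant Xr"
      "\<forall>j\<in>{1..l}. \<exists>f\<in>Xr. \<forall>x. t (j - 1) \<le> N x \<and> N x \<le> t j \<longrightarrow> \<Phi> (N x) = f x"
      and Xr: "fun_space_of_dim Xr r"
      and g: "set_integrable \<mu> \<Omega> g" "(LINT y:\<Omega>|\<mu>. \<bar>g y\<bar>) = 1" and n: "2 \<le> n"
    have ar: "annular_regular \<mu> N \<Omega> c4 c5 \<beta>"
      using H assms by (intro annular_regular.intro annular_regular_axioms.intro) auto
    have k: "kernel_ok N \<Phi> t l Xr" using \<Phi> by (simp add: kernel_ok_def)
    obtain B where B: "finite B" "card B = r" "fun_vs.span B = Xr"
      using Xr by (auto simp: fun_space_of_dim_def)
    obtain y lam where y: "\<forall>k\<in>{1..n}. y k \<in> \<Omega>"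
      "\<And>x. x \<in> \<Omega> \<Longrightarrow> \<bar>(LINT z:\<Omega>|\<mu>. \<Phi> (N (x - z)) * g z) - (\<Sum>k=1..n. lam k * \<Phi> (N (x - y k)))\<bar>
        \<le> C * quadrature_rate \<beta> n"
      using main[OF ar k B g n] by blast
    have "(SUP x\<in>\<Omega>. ereal \<bar>(LINT z:\<Omega>|\<mu>. \<Phi> (N (x - z)) * g z)
        - (\<Sum>k=1..n. lam k * \<Phi> (N (x - y k)))\<bar>) \<le> ereal (C * quadrature_rate \<beta> n)"
      by (intro SUP_least ereal_less_eq(3)[THEN iffD2] y(2))
    then show "\<exists>y lam. (\<forall>k\<in>{1..n}. y k \<in> \<Omega>) \<and>
         (SUP x\<in>\<Omega>. ereal \<bar>(LINT z:\<Omega>|\<mu>. \<Phi> (N (x - z)) * g z)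
                      - (\<Sum>k=1..n. lam k * \<Phi> (N (x - y k)))\<bar>)
           \<le> ereal (C * quadrature_rate \<beta> n)"
      using y(1) by blast
  qed
qed

end
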